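(* Let $\Omega \subset \mathbb{R}^2$ be a non-empty, open, bounded, convex set. Then \[ \sup_{K \in \mathcal{K}_2} \mathcal{J}_\Omega[K] = +\infty. \]
   Context: $\mathcal{K}_2$ denotes the class of non-empty, open, bounded, convex subsets of $\mathbb{R}^2$ that are centrally symmetric with respect to the origin. For $K \in \mathcal{K}_2$, the polar set is $K^\circ := \{x \in \mathbb{R}^2 : x\cdot y < 1 \text{ for every } y \in K\}$, and the polar norm is $\Phi_K^\circ(x) := \sup\{x\cdot y : y \in K\}$ for $x\in\mathbb{R}^2$. The anisotropic perimeter of a Borel set $E\subset\mathbb{R}^2$ is \[ \mathrm{Per}_K(E) := \int_{\partial^* E} \Phi_K^\circ(\nu_E(x))\, d\mathcal{H}^{1}(x), \] where $\partial^*E$ is the reduced boundary of $E$, $\nu_E$ the measure-theoretic unit normal and $\mathcal{H}^1$ the one-dimensional Hausdorff measure (with the usual convention that the perimeter is $+\infty$ if $E$ does not have finite perimeter). Writing $|\cdot|$ for two-dimensional Lebesgue measure, the $K$-Cheeger constant of $\Omega$ is \[ h_K(\Omega) := \inf\left\{ \frac{\mathrm{Per}_K(E)}{|E|} : E \subset \Omega,\ |E|>0\right\}, \] and $\mathcal{J}_\Omega[K] := h_K(\Omega)\,|K^\circ|^{1/2}$. *)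

theory Defs
  imports "HOL-Analysis.Analysis"
begin

section \<open>Symmetric convex bodies and polarity\<close>

definition sym_convex_sets :: "(real^2) set set" where
  "sym_convex_sets =
     {K. K \<noteq> {} \<and> open K \<and> bounded K \<and> convex K \<and> (\<forall>x\<in>K. - x \<in> K)}"

definition polar :: "(real^2) set \<Rightarrow> (real^2) set" where
  "polar K = {x. \<forall>y\<in>K. x \<bullet> y < 1}"

definition polar_norm :: "(real^2) set \<Rightarrow> real^2 \<Rightarrow> real" where
  "polar_norm K x = (SUP y\<in>K. x \<bullet> y)"


section \<open>One-dimensional Hausdorff measure\<close>

text \<open>
  The usual normalising constant of the \<open>s\<close>-dimensional measure is the volume of the
  \<open>s\<close>-dimensional unit ball divided by \<open>2 ^ s\<close>, which is \<open>1\<close> for \<open>s = 1\<close>.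
  Boundedness is required of the covering sets because \<^const>\<open>diameter\<close> is
  unspecified on unbounded sets.
\<close>

definition hausdorff1_outer :: "(real^2) set \<Rightarrow> ennreal" where
  "hausdorff1_outer A =
     (SUP \<delta>\<in>{0<..}.
        INF C\<in>{C :: nat \<Rightarrow> (real^2) set.
                 A \<subseteq> (\<Union>i. C i) \<and> (\<forall>i. bounded (C i) \<and> diameter (C i) \<le> \<delta>)}.
          \<Sum>i. ennreal (diameter (C i)))"

text \<open>
  \<open>hausdorff1_outer\<close> is a metric outer measure, hence countably additive on the Borel
  sets by Caratheodory's criterion, so \<^const>\<open>measure_of\<close> does not fall back to the
  null measure here.
\<close>

definition hausdorff1 :: "(real^2) measure" where
  "hausdorff1 = measure_of UNIV (sets borel) hausdorff1_outer"


section \<open>Sets of finite perimeter\<close>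

definition C1_compact_support :: "(real^2 \<Rightarrow> real^2) \<Rightarrow> bool" where
  "C1_compact_support \<phi> \<longleftrightarrow>
     (\<forall>x. \<phi> differentiable (at x)) \<and>
     (\<forall>v. continuous_on UNIV (\<lambda>x. frechet_derivative \<phi> (at x) v)) \<and>
     compact (closure {x. \<phi> x \<noteq> 0})"

definition divergence :: "(real^2 \<Rightarrow> real^2) \<Rightarrow> real^2 \<Rightarrow> real" where
  "divergence \<phi> x = (\<Sum>i\<in>UNIV. frechet_derivative \<phi> (at x) (axis i 1) $ i)"

text \<open>
  A Borel set has finite perimeter if the distributional derivative of its indicator
  function is a finite vector-valued Borel measure.  Such a vector measure is
  represented by its polar decomposition: a finite positive measure \<open>\<mu>\<close> (its total
  variation) and a density \<open>\<sigma>\<close> of unit length.  The sign is chosen so that \<open>\<sigma>\<close> points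
  outwards.
\<close>

definition gauss_green ::
  "(real^2) set \<Rightarrow> (real^2) measure \<times> (real^2 \<Rightarrow> real^2) \<Rightarrow> bool" where
  "gauss_green E = (\<lambda>(\<mu>, \<sigma>).
     sets \<mu> = sets borel \<and> finite_measure \<mu> \<and>
     \<sigma> \<in> borel_measurable borel \<and> (AE x in \<mu>. norm (\<sigma> x) = 1) \<and>
     (\<forall>\<phi>. C1_compact_support \<phi> \<longrightarrow>
        (LINT x:E|lborel. divergence \<phi> x) = (LINT x|\<mu>. \<phi> x \<bullet> \<sigma> x)))"

definition finite_perimeter :: "(real^2) set \<Rightarrow> bool" where
  "finite_perimeter E \<longleftrightarrow> E \<in> sets borel \<and> (\<exists>p. gauss_green E p)"

text \<open>
  The polar decomposition is unique (\<open>\<sigma>\<close> up to a \<open>\<mu>\<close>-null set), so the notions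
  below do not depend on the choice made here.
\<close>

definition perimeter_measure :: "(real^2) set \<Rightarrow> (real^2) measure" where
  "perimeter_measure E = fst (SOME p. gauss_green E p)"

definition perimeter_density :: "(real^2) set \<Rightarrow> real^2 \<Rightarrow> real^2" where
  "perimeter_density E = snd (SOME p. gauss_green E p)"

definition mean_normal :: "(real^2) set \<Rightarrow> real^2 \<Rightarrow> real \<Rightarrow> real^2" where
  "mean_normal E x r =
     (LINT y:ball x r|perimeter_measure E. perimeter_density E y)
       /\<^sub>R measure (perimeter_measure E) (ball x r)"

text \<open>De Giorgi's reduced boundary and the measure-theoretic unit normal on it.\<close>

definition reduced_boundary :: "(real^2) set \<Rightarrow> (real^2) set" where
  "reduced_boundary E =
     {x. (\<forall>r>0. measure (perimeter_measure E) (ball x r) > 0) \<and>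
         (\<exists>\<nu>. norm \<nu> = 1 \<and> (mean_normal E x \<longlongrightarrow> \<nu>) (at_right 0))}"

definition unit_normal :: "(real^2) set \<Rightarrow> real^2 \<Rightarrow> real^2" where
  "unit_normal E x = Lim (at_right 0) (mean_normal E x)"


section \<open>Anisotropic perimeter and Cheeger constant\<close>

definition aniso_perimeter :: "(real^2) set \<Rightarrow> (real^2) set \<Rightarrow> ennreal" where
  "aniso_perimeter K E =
     (if finite_perimeter E
      then \<integral>\<^sup>+x\<in>reduced_boundary E. ennreal (polar_norm K (unit_normal E x)) \<partial>hausdorff1
      else \<infinity>)"

definition cheeger_const :: "(real^2) set \<Rightarrow> (real^2) set \<Rightarrow> ennreal" where
  "cheeger_const K \<Omega> =
     (INF E\<in>{E \<in> sets borel. E \<subseteq> \<Omega> \<and> emeasure lborel E > 0}.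
        aniso_perimeter K E / emeasure lborel E)"

definition cheeger_functional :: "(real^2) set \<Rightarrow> (real^2) set \<Rightarrow> ennreal" where
  "cheeger_functional \<Omega> K =
     cheeger_const K \<Omega> * ennreal (sqrt (measure lborel (polar K)))"

end

theory Submission
  imports Defs
begin

text \<open>
  For the thin rectangle \<open>K = {|x\<^sub>1| < 1, |x\<^sub>2| < \<epsilon>}\<close> the area of \<open>K\<degree>\<close> is of order \<open>1 / \<epsilon>\<close>, while
  \<open>\<Phi>\<^sub>K\<degree>(\<nu>) \<ge> |\<nu>\<^sub>1|\<close> for every \<open>\<epsilon>\<close>.  Testing the Gauss-Green formula for \<open>E \<subseteq> \<Omega>\<close> with a truncation of the field
  \<open>(y\<^sub>1, 0)\<close> bounds \<open>|E|\<close> by a multiple of \<open>\<integral> |\<sigma>\<^sub>1| d\<mu>\<close>, where \<open>\<sigma> \<mu>\<close> is the distributional derivative of the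
  indicator function of \<open>E\<close>, with a constant depending only on \<open>\<Omega>\<close>.  So the Cheeger constants stay bounded
  below as \<open>\<epsilon>\<close> tends to \<open>0\<close>, once \<open>\<mu>\<close> is known to be concentrated on the reduced boundary and
  dominated there by a multiple of the Hausdorff measure.  This weak half of De Giorgi's structure
  theorem has an elementary proof: the Lebesgue-Besicovitch differentiation theorem gives the
  concentration, and \<open>\<mu>(B(x, r)) = O(r)\<close> at points of the reduced boundary, with a universal
  constant, gives the domination.
\<close>


text \<open>A lower bound on the perimeter is all that is wanted, so only the inequality of
  \<open>\<mu>\<close> against the Hausdorff measure is proved, not the exact density. Its constant
  171 must not depend on the point or on \<open>E\<close>, since it enters the bound
  \<open>1 / (1368 * R)\<close> for the Cheeger constants, where 1368 = 8 * 171. The uniformity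
  comes from an estimate of the mass at radius \<open>r\<close> by that at radius
  \<open>2 * r\<close> with factor 1/4. This beats the factor 1/2 of linear scaling, so the data at
  the initial radius contribute only O(r^2). Two obstacles shape the rest. And the objects are
  defined by total functions: \<open>hausdorff1\<close> is meaningful only after its outer measure
  is shown to be countably additive on Borel sets, and the reduced boundary is not known to be
  Borel, so the comparison is made on a Borel subset of full \<open>\<mu>\<close>-measure.\<close>

section \<open>Metric outer measures\<close>

text \<open>
  The points of \<open>X\<close> off the closed set \<open>C\<close> are exhausted by the sets \<open>A n\<close> at distance at
  least \<open>1 / (n + 1)\<close> from \<open>C\<close>.  Rings \<open>A (n + 1) - A n\<close> whose indices differ by at least two are
  at positive distance from each other, which makes the series of their measures converge.
\<close>

lemma closed_caratheodory_measurable: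
  fixes f :: "'a::metric_space set \<Rightarrow> ennreal"
  assumes empty: "f {} = 0" and mono: "\<And>A B. A \<subseteq> B \<Longrightarrow> f A \<le> f B"
    and sub: "\<And>B :: nat \<Rightarrow> 'a set. f (\<Union>i. B i) \<le> (\<Sum>i. f (B i))"
    and metric: "\<And>A B d. 0 < d \<Longrightarrow> (\<forall>x\<in>A. \<forall>y\<in>B. d \<le> dist x y) \<Longrightarrow>
      f A + f B \<le> f (A \<union> B)"
    and "closed C"
  shows "f (X \<inter> C) + f (X - C) \<le> f X"
proof (cases "f X = \<infinity> \<or> C = {}")
  case True
  then show ?thesis
    by (auto simp: empty)
next
  case False
  have sub2: "f (A \<union> B) \<le> f A + f B" for A B
    using sub[of "binaryset A B"] by (simp add: suminf_binaryset_eq UN_binaryset_eq empty)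
  \<comment> \<open>Here \<open>C\<close> is non-empty. For empty \<open>C\<close> the convention
    \<open>infdist x {} = 0\<close> would make every \<open>A n\<close> empty, which is why that
    case is split off.\<close>
  define A where "A n = {x \<in> X - C. 1 / real (Suc n) \<le> infdist x C}" for n
  define R where "R n = A (Suc n) - A n" for n
  have A_mono: "A m \<subseteq> A n" if "m \<le> n" for m n
  proof -
    have "1 / real (Suc n) \<le> 1 / real (Suc m)" using that by (intro divide_left_mono) auto
    then show ?thesis by (auto simp: A_def)
  qed
  have step: "f (A n) + f (R (Suc n)) \<le> f (A (Suc (Suc n)))" for n
  proof -
    have "f (A n) + f (R (Suc n)) \<le> f (A n \<union> R (Suc n))"
    proof (intro metric[where d = "1 / real (Suc n) - 1 / real (Suc (Suc n))"] ballI)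
      show "0 < 1 / real (Suc n) - 1 / real (Suc (Suc n))"
        by (simp add: field_simps add_pos_nonneg)
      fix x y assume xy: "x \<in> A n" "y \<in> R (Suc n)"
      have "infdist x C \<le> infdist y C + dist x y" by (rule infdist_triangle)
      moreover have "1 / real (Suc n) \<le> infdist x C" using xy by (auto simp: A_def)
      moreover have "infdist y C < 1 / real (Suc (Suc n))"
        using xy by (auto simp: A_def R_def simp del: of_nat_Suc)
      ultimately show "1 / real (Suc n) - 1 / real (Suc (Suc n)) \<le> dist x y" by linarith
    qed
    also have "\<dots> \<le> f (A (Suc (Suc n)))"
      using A_mono[of n "Suc (Suc n)"] by (intro mono) (auto simp: R_def)
    finally show ?thesis .
  qed
  \<comment> \<open>Keeping two consecutive terms on the right lets one induction treat the even and
    the odd rings together: each step absorbs a new ring into the older of the two terms.\<close>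
  have partial: "(\<Sum>k<n. f (R (Suc k))) \<le> f (A n) + f (A (Suc n))" for n
  proof (induction n)
    case (Suc n)
    have "(\<Sum>k<Suc n. f (R (Suc k))) \<le> f (A (Suc n)) + (f (A n) + f (R (Suc n)))"
      using add_right_mono[OF Suc, of "f (R (Suc n))"] by (simp add: ac_simps)
    also have "\<dots> \<le> f (A (Suc n)) + f (A (Suc (Suc n)))"
      by (intro add_left_mono step)
    finally show ?case .
  qed simp
  have AX: "f (A n) \<le> f X" for n by (rule mono) (auto simp: A_def)
  have "(\<Sum>k. f (R (Suc k))) \<le> f X + f X"
    using order_trans[OF partial add_mono[OF AX AX]] by (intro suminf_le_const) auto
  then have fin: "(\<Sum>k. f (R (Suc k))) \<noteq> \<infinity>"
    using False by (auto simp: top_unique)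
  define r where "r k = enn2real (f (R (Suc k)))" for k
  have r_nonneg: "0 \<le> r k" for k by (simp add: r_def)
  have fR: "f (R (Suc k)) = ennreal (r k)" for k
  proof -
    have "f (R (Suc k)) \<le> f X" by (rule mono) (auto simp: A_def R_def)
    then show ?thesis using False by (auto simp: r_def less_top top_unique)
  qed
  have summ: "summable r"
    using fin unfolding fR by (intro summable_suminf_not_top r_nonneg) simp
  show ?thesis
  proof (rule ennreal_le_epsilon)
    fix e :: real assume "0 < e" 
    obtain n where n: "norm (\<Sum>i. r (i + n)) < e"
      using suminf_exist_split[OF \<open>0 < e\<close> summ] by blast
    have cover: "X - C \<subseteq> A (Suc n) \<union> (\<Union>i. R (Suc (i + n)))"
    proof
      fix x assume x: "x \<in> X - C"
      then have "0 < infdist x C"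
        using False \<open>closed C\<close> in_closed_iff_infdist_zero infdist_nonneg
        by (metis Diff_iff less_eq_real_def)
      then obtain m where "1 / real (Suc m) < infdist x C"
        using reals_Archimedean by (auto simp: inverse_eq_divide)
      then have ex: "\<exists>m. x \<in> A m" using x by (auto simp: A_def intro: less_imp_le)
      define m where "m = (LEAST m. x \<in> A m)"
      have m: "x \<in> A m" "\<And>k. k < m \<Longrightarrow> x \<notin> A k"
        using LeastI_ex[OF ex] not_less_Least unfolding m_def by blast+
      show "x \<in> A (Suc n) \<union> (\<Union>i. R (Suc (i + n)))"
      proof (cases "m \<le> Suc n")
        case True then show ?thesis using m A_mono by blast
      next
        case False
        then obtain i where i: "m = Suc (Suc (i + n))"
          by (metis add.commute less_natE not_le add_Suc_right)
        have "x \<in> R (Suc (i + n))" using m(1) m(2)[of "Suc (i + n)"] by (simp add: R_def i)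
        then show ?thesis by blast
      qed
    qed
    have "f (X - C) \<le> f (A (Suc n)) + f (\<Union>i. R (Suc (i + n)))"
      using mono[OF cover] sub2 order_trans by blast
    also have "f (\<Union>i. R (Suc (i + n))) \<le> (\<Sum>i. f (R (Suc (i + n))))"
      by (rule sub)
    also have "\<dots> = ennreal (\<Sum>i. r (i + n))"
      unfolding fR using summ
      by (intro suminf_ennreal_eq summable_sums summable_ignore_initial_segment r_nonneg)
    also have "\<dots> \<le> ennreal e" using n by (intro ennreal_leI) auto
    finally have *: "f (X - C) \<le> f (A (Suc n)) + ennreal e" by (simp add: add_left_mono)
    have "f (X \<inter> C) + f (A (Suc n)) \<le> f ((X \<inter> C) \<union> A (Suc n))"
    proof (intro metric[where d = "1 / real (Suc (Suc n))"] ballI)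
      show "0 < 1 / real (Suc (Suc n))" by simp
      fix x y assume xy: "x \<in> X \<inter> C" "y \<in> A (Suc n)"
      have "infdist y C \<le> dist y x" using xy by (auto intro: infdist_le)
      then show "1 / real (Suc (Suc n)) \<le> dist x y"
        using xy by (auto simp: A_def dist_commute)
    qed
    also have "\<dots> \<le> f X" by (rule mono) (auto simp: A_def)
    finally have le_X: "f (X \<inter> C) + f (A (Suc n)) \<le> f X" .
    have "f (X \<inter> C) + f (X - C) \<le> f (X \<inter> C) + (f (A (Suc n)) + ennreal e)"
      by (intro add_left_mono *)
    also have "\<dots> = f (X \<inter> C) + f (A (Suc n)) + ennreal e" by (rule add.assoc[symmetric])
    also have "\<dots> \<le> f X + ennreal e" by (intro add_right_mono le_X)
    finally show "f (X \<inter> C) + f (X - C) \<le> f X + ennreal e" .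
  qed
qed

text \<open>The Caratheodory-measurable sets form a sigma-algebra on which \<open>f\<close> is
  countably additive. It contains the closed sets, and these generate the Borel sets.\<close>

lemma metric_outer_measure_imp_measure_space:
  fixes f :: "'a::metric_space set \<Rightarrow> ennreal"
  assumes empty: "f {} = 0" and mono: "\<And>A B. A \<subseteq> B \<Longrightarrow> f A \<le> f B"
    and sub: "\<And>B :: nat \<Rightarrow> 'a set. f (\<Union>i. B i) \<le> (\<Sum>i. f (B i))"
    and metric: "\<And>A B d. 0 < d \<Longrightarrow> (\<forall>x\<in>A. \<forall>y\<in>B. d \<le> dist x y) \<Longrightarrow>
      f A + f B \<le> f (A \<union> B)"
  shows "measure_space UNIV (sets borel) f"
proof -
  interpret sigma_algebra UNIV "UNIV :: 'a set set"
    using sigma_algebra_Pow[of "UNIV :: 'a set"] by simp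
  have "outer_measure_space UNIV f"
    using empty mono sub
    by (auto simp: outer_measure_space_def positive_def increasing_def countably_subadditive_def)
  then have ms: "measure_space UNIV (lambda_system UNIV UNIV f) f"
    by (rule caratheodory_lemma)
  have sub2: "f (A \<union> B) \<le> f A + f B" for A B
    using sub[of "binaryset A B"] by (simp add: suminf_binaryset_eq UN_binaryset_eq empty)
  have "C \<in> lambda_system UNIV UNIV f" if "closed C" for C
  proof -
    have "f (X \<inter> C) + f (X - C) = f X" for X
    proof (rule antisym)
      show "f (X \<inter> C) + f (X - C) \<le> f X"
        using closed_caratheodory_measurable[OF empty mono sub metric that] .
      have "f ((X \<inter> C) \<union> (X - C)) \<le> f (X \<inter> C) + f (X - C)"
        by (rule sub2)
      then show "f X \<le> f (X \<inter> C) + f (X - C)" by (simp add: Int_Diff_Un)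
    qed
    then show ?thesis by (simp add: lambda_system_eq)
  qed
  then have "sigma_sets UNIV {C :: 'a set. closed C} \<subseteq> lambda_system UNIV UNIV f"
    using ms unfolding measure_space_def
    by (intro sigma_algebra.sigma_sets_subset) auto
  then have "sets borel \<subseteq> lambda_system UNIV UNIV f"
    by (simp add: borel_eq_closed sets_measure_of_conv)
  then show ?thesis
    using measure_down[OF ms] sets.sigma_algebra_axioms[of "borel :: 'a measure"] by simp
qed


section \<open>One-dimensional Hausdorff measure\<close>

text \<open>The infimum at a fixed scale inside \<open>hausdorff1_outer\<close>, named so that
  covering arguments can be run at each scale before the supremum is taken.\<close>

definition hausdorff1_pre :: "real \<Rightarrow> (real^2) set \<Rightarrow> ennreal" where
  "hausdorff1_pre \<delta> A =
     (INF C\<in>{C :: nat \<Rightarrow> (real^2) set.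
              A \<subseteq> (\<Union>i. C i) \<and> (\<forall>i. bounded (C i) \<and> diameter (C i) \<le> \<delta>)}.
        \<Sum>i. ennreal (diameter (C i)))"

lemma hausdorff1_outer_eq: "hausdorff1_outer A = (SUP \<delta>\<in>{0<..}. hausdorff1_pre \<delta> A)"
  by (simp add: hausdorff1_outer_def hausdorff1_pre_def)

lemma hausdorff1_pre_le:
  fixes C :: "nat \<Rightarrow> (real^2) set"
  assumes "A \<subseteq> (\<Union>i. C i)" "\<And>i. bounded (C i)" "\<And>i. diameter (C i) \<le> \<delta>"
  shows "hausdorff1_pre \<delta> A \<le> (\<Sum>i. ennreal (diameter (C i)))"
  unfolding hausdorff1_pre_def using assms by (intro INF_lower) auto

lemma hausdorff1_pre_le_outer: "0 < \<delta> \<Longrightarrow> hausdorff1_pre \<delta> A \<le> hausdorff1_outer A"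
  unfolding hausdorff1_outer_eq by (intro SUP_upper) auto

lemma hausdorff1_outer_empty: "hausdorff1_outer {} = 0"
proof -
  have "hausdorff1_pre \<delta> {} \<le> 0" if "0 < \<delta>" for \<delta>
    using hausdorff1_pre_le[of "{}" "\<lambda>_. {}" \<delta>] that by simp
  then have "hausdorff1_outer {} \<le> 0"
    unfolding hausdorff1_outer_eq by (intro SUP_least) auto
  then show ?thesis by simp
qed

lemma hausdorff1_outer_mono: "A \<subseteq> B \<Longrightarrow> hausdorff1_outer A \<le> hausdorff1_outer B"
  unfolding hausdorff1_outer_def by (intro SUP_mono' INF_superset_mono) auto

text \<open>Near-optimal covers of the \<open>B i\<close> with errors \<open>e / 2 ^ (i + 1)\<close>
  are merged into one sequence by the pairing bijection. Finiteness of the sum makes the infima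
  strictly smaller than infimum plus error.\<close>

lemma hausdorff1_pre_countably_subadditive:
  fixes B :: "nat \<Rightarrow> (real^2) set"
  shows "hausdorff1_pre \<delta> (\<Union>i. B i) \<le> (\<Sum>i. hausdorff1_pre \<delta> (B i))"
proof (cases "(\<Sum>i. hausdorff1_pre \<delta> (B i)) = \<infinity>")
  case False
  show ?thesis
  proof (rule ennreal_le_epsilon)
    fix e :: real assume "0 < e"
    have "\<exists>C :: nat \<Rightarrow> (real^2) set. B i \<subseteq> (\<Union>j. C j) \<and> (\<forall>j. bounded (C j) \<and> diameter (C j) \<le> \<delta>) \<and>
        (\<Sum>j. ennreal (diameter (C j))) \<le> hausdorff1_pre \<delta> (B i) + ennreal (e * (1/2) ^ Suc i)" for i
    proof -
      have "hausdorff1_pre \<delta> (B i) \<noteq> \<infinity>"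
        using False ennreal_suminf_lessD[of "\<lambda>i. hausdorff1_pre \<delta> (B i)" \<infinity> i] by (auto simp: less_top)
      then have "hausdorff1_pre \<delta> (B i) < hausdorff1_pre \<delta> (B i) + ennreal (e * (1/2) ^ Suc i)"
        using \<open>0 < e\<close> by (simp add: less_top)
      then show ?thesis
        unfolding hausdorff1_pre_def[of \<delta> "B i"] INF_less_iff by (auto intro: less_imp_le)
    qed
    then obtain C :: "nat \<Rightarrow> nat \<Rightarrow> (real^2) set"
      where C: "\<And>i. B i \<subseteq> (\<Union>j. C i j)" "\<And>i j. bounded (C i j)" "\<And>i j. diameter (C i j) \<le> \<delta>"
        "\<And>i. (\<Sum>j. ennreal (diameter (C i j))) \<le> hausdorff1_pre \<delta> (B i) + ennreal (e * (1/2) ^ Suc i)"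
      by metis
    define D where "D n = case_prod C (prod_decode n)" for n
    have "(\<Union>i. B i) \<subseteq> (\<Union>n. D n)"
    proof
      fix x assume "x \<in> (\<Union>i. B i)"
      then obtain i j where "x \<in> C i j" using C(1) by blast
      then have "x \<in> D (prod_encode (i, j))" by (simp add: D_def)
      then show "x \<in> (\<Union>n. D n)" by blast
    qed
    then have "hausdorff1_pre \<delta> (\<Union>i. B i) \<le> (\<Sum>n. ennreal (diameter (D n)))"
      using C by (intro hausdorff1_pre_le) (auto simp: D_def split: prod.split)
    also have "\<dots> = (\<Sum>i. \<Sum>j. ennreal (diameter (C i j)))"
      using suminf_ennreal_2dimen[of _ "\<lambda>p. ennreal (diameter (case_prod C p))", OF refl]
      by (simp add: D_def)
    also have "\<dots> \<le> (\<Sum>i. hausdorff1_pre \<delta> (B i) + ennreal (e * (1/2) ^ Suc i))"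
      by (intro suminf_le C) auto
    also have "\<dots> = (\<Sum>i. hausdorff1_pre \<delta> (B i)) + (\<Sum>i. ennreal (e * (1/2) ^ Suc i))"
      by (intro suminf_add[symmetric]) auto
    also have "(\<Sum>i. ennreal (e * (1/2) ^ Suc i)) = ennreal e"
      using sums_mult[OF power_half_series, of e] \<open>0 < e\<close> by (intro suminf_ennreal_eq) auto
    finally show "hausdorff1_pre \<delta> (\<Union>i. B i) \<le> (\<Sum>i. hausdorff1_pre \<delta> (B i)) + ennreal e" .
  qed
qed simp

lemma hausdorff1_outer_countably_subadditive:
  fixes B :: "nat \<Rightarrow> (real^2) set"
  shows "hausdorff1_outer (\<Union>i. B i) \<le> (\<Sum>i. hausdorff1_outer (B i))"
  unfolding hausdorff1_outer_eq[of "\<Union>i. B i"]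
proof (rule SUP_least)
  fix \<delta> :: real assume "\<delta> \<in> {0<..}"
  then have "(\<Sum>i. hausdorff1_pre \<delta> (B i)) \<le> (\<Sum>i. hausdorff1_outer (B i))"
    by (intro suminf_le hausdorff1_pre_le_outer) auto
  then show "hausdorff1_pre \<delta> (\<Union>i. B i) \<le> (\<Sum>i. hausdorff1_outer (B i))"
    using hausdorff1_pre_countably_subadditive order_trans by blast
qed

text \<open>A set of diameter less than \<open>d\<close> cannot meet both \<open>A\<close> and
  \<open>B\<close>, so a fine cover of the union splits into covers of the two parts.\<close>

lemma hausdorff1_outer_metric:
  fixes A B :: "(real^2) set"
  assumes "0 < d" and sep: "\<forall>x\<in>A. \<forall>y\<in>B. d \<le> dist x y"
  shows "hausdorff1_outer A + hausdorff1_outer B \<le> hausdorff1_outer (A \<union> B)"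
proof -
  \<comment> \<open>The two scales are kept independent so that the two suprema can be taken one
    after the other.\<close>
  have *: "hausdorff1_pre \<delta>\<^sub>1 A + hausdorff1_pre \<delta>\<^sub>2 B \<le> hausdorff1_outer (A \<union> B)"
    if "0 < \<delta>\<^sub>1" "0 < \<delta>\<^sub>2" for \<delta>\<^sub>1 \<delta>\<^sub>2
  proof -
    define \<delta> where "\<delta> = min (min \<delta>\<^sub>1 \<delta>\<^sub>2) (d / 2)"
    have \<delta>: "0 < \<delta>" "\<delta> \<le> \<delta>\<^sub>1" "\<delta> \<le> \<delta>\<^sub>2" "\<delta> < d" using that \<open>0 < d\<close> by (auto simp: \<delta>_def)
    have "hausdorff1_pre \<delta>\<^sub>1 A + hausdorff1_pre \<delta>\<^sub>2 B \<le> hausdorff1_pre \<delta> (A \<union> B)"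
      unfolding hausdorff1_pre_def[of \<delta>]
    proof (rule INF_greatest, clarify)
      fix C :: "nat \<Rightarrow> (real^2) set"
      assume cover: "A \<union> B \<subseteq> (\<Union>i. C i)" and C: "\<forall>i. bounded (C i) \<and> diameter (C i) \<le> \<delta>"
      \<comment> \<open>Discarded sets become empty rather than being dropped. The empty set has
        diameter 0, so the two series add up term by term to the original one.\<close>
      define CA where "CA i = (if C i \<inter> A = {} then {} else C i)" for i
      define CB where "CB i = (if C i \<inter> A = {} then C i else {})" for i
      have disj: "C i \<inter> A = {} \<or> C i \<inter> B = {}" for i
      proof (rule ccontr)
        assume "\<not> (C i \<inter> A = {} \<or> C i \<inter> B = {})"
        then obtain x y where "x \<in> C i" "x \<in> A" "y \<in> C i" "y \<in> B" by blast
        then have "dist x y \<le> diameter (C i)" "d \<le> dist x y"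
          using sep C by (auto intro: diameter_bounded_bound)
        then show False using C \<delta> by (smt (verit))
      qed
      have "A \<subseteq> (\<Union>i. CA i)" using cover by (auto simp: CA_def) (use cover in blast)
      moreover have "B \<subseteq> (\<Union>i. CB i)" using cover disj by (auto simp: CB_def) blast
      ultimately have "hausdorff1_pre \<delta>\<^sub>1 A + hausdorff1_pre \<delta>\<^sub>2 B \<le>
          (\<Sum>i. ennreal (diameter (CA i))) + (\<Sum>i. ennreal (diameter (CB i)))"
        using C \<delta> that by (intro add_mono hausdorff1_pre_le) (auto simp: CA_def CB_def intro: order_trans)
      also have "\<dots> = (\<Sum>i. ennreal (diameter (CA i)) + ennreal (diameter (CB i)))"
        by (intro suminf_add) auto
      also have "(\<lambda>i. ennreal (diameter (CA i)) + ennreal (diameter (CB i))) = (\<lambda>i. ennreal (diameter (C i)))"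
        by (auto simp: CA_def CB_def)
      finally show "hausdorff1_pre \<delta>\<^sub>1 A + hausdorff1_pre \<delta>\<^sub>2 B \<le> (\<Sum>i. ennreal (diameter (C i)))" .
    qed
    also have "\<dots> \<le> hausdorff1_outer (A \<union> B)" using \<delta> by (intro hausdorff1_pre_le_outer)
    finally show ?thesis .
  qed
  have "hausdorff1_pre \<delta>\<^sub>1 A + hausdorff1_outer B \<le> hausdorff1_outer (A \<union> B)" if "0 < \<delta>\<^sub>1" for \<delta>\<^sub>1
    unfolding hausdorff1_outer_eq[of B] using *[OF that]
    by (subst ennreal_SUP_add_right) (auto intro: SUP_least)
  then show ?thesis
    unfolding hausdorff1_outer_eq[of A] add.commute[of _ "hausdorff1_outer B"]
    by (subst ennreal_SUP_add_right) (auto intro: SUP_least)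
qed

lemma sets_hausdorff1 [simp, measurable_cong]: "sets hausdorff1 = sets borel"
  using sets.sigma_sets_eq[of "borel :: (real^2) measure"]
  by (simp add: hausdorff1_def)

text \<open>This excludes the null measure to which \<open>measure_of\<close> defaults. With that
  default every anisotropic perimeter of a set of finite perimeter would be 0.\<close>

lemma emeasure_hausdorff1: "A \<in> sets borel \<Longrightarrow> emeasure hausdorff1 A = hausdorff1_outer A"
proof -
  assume A: "A \<in> sets borel"
  have "measure_space UNIV (sets borel) hausdorff1_outer"
    using hausdorff1_outer_empty hausdorff1_outer_mono hausdorff1_outer_countably_subadditive
      hausdorff1_outer_metric
    by (rule metric_outer_measure_imp_measure_space)
  then show ?thesis
    unfolding hausdorff1_def measure_space_def using A
    by (intro emeasure_measure_of_sigma) auto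
qed


section \<open>Besicovitch's covering theorem\<close>

text \<open>Finitely many balls of radius 1/4 cover the unit sphere, and two points of one such ball
  are less than 1/2 apart, so no ball receives two directions.\<close>

lemma separated_directions_bounded:
  "\<exists>N. \<forall>(S :: 'b set) (u :: 'b \<Rightarrow> 'a::euclidean_space).
     (\<forall>x\<in>S. norm (u x) = 1) \<longrightarrow> (\<forall>x\<in>S. \<forall>y\<in>S. x \<noteq> y \<longrightarrow> 1/2 \<le> dist (u x) (u y)) \<longrightarrow>
     finite S \<and> card S \<le> N"
proof -
  have "compact (sphere 0 1 :: 'a set)" by simp
  then obtain k :: "'a set" where k: "finite k" "sphere 0 1 \<subseteq> (\<Union>c\<in>k. ball c (1/4))"
    unfolding compact_eq_totally_bounded by (meson zero_less_divide_1_iff zero_less_numeral)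
  show ?thesis
  proof (intro exI allI impI)
    fix S :: "'b set" and u :: "'b \<Rightarrow> 'a"
    assume u: "\<forall>x\<in>S. norm (u x) = 1" and sep: "\<forall>x\<in>S. \<forall>y\<in>S. x \<noteq> y \<longrightarrow> 1/2 \<le> dist (u x) (u y)"
    have "\<forall>x\<in>S. \<exists>c\<in>k. dist c (u x) < 1/4"
      using u k(2) by (fastforce simp: subset_iff)
    then obtain g where g: "\<And>x. x \<in> S \<Longrightarrow> g x \<in> k" "\<And>x. x \<in> S \<Longrightarrow> dist (g x) (u x) < 1/4"
      by metis
    have "inj_on g S"
    proof (rule inj_onI, rule ccontr)
      fix x y assume xy: "x \<in> S" "y \<in> S" "g x = g y" "x \<noteq> y"
      have "dist (u x) (u y) \<le> dist (g x) (u x) + dist (g y) (u y)"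
        using xy(3) dist_triangle3[of "u x" "u y" "g x"] by simp
      then show False using g(2)[of x] g(2)[of y] sep xy by fastforce
    qed
    then show "finite S \<and> card S \<le> card k"
      using g(1) k(1) by (meson card_inj_on_le image_subsetI inj_on_finite)
  qed
qed

text \<open>Here \<open>a\<close> and \<open>b\<close> are two centres seen from the common point,
  with radii \<open>r\<close> and \<open>s\<close>. If \<open>b\<close> is the longer vector, the
  triangle inequality loses at most \<open>norm b - norm a\<close>, and \<open>norm b\<close>
  exceeds \<open>r\<close> by at most \<open>r / 5\<close>. The requirement
  \<open>2/5 * r \<le> norm a\<close> makes that excess at most half of
  \<open>norm a\<close>.\<close>

lemma directions_separated:
  fixes a b :: "'a::real_normed_vector"
  assumes a: "norm a < r" and b: "norm b < s" and ab: "r \<le> norm (a - b)" and sr: "s \<le> 6/5 * r"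
    and far: "2/5 * r \<le> norm a" "b \<noteq> 0"
  shows "1/2 \<le> norm (a /\<^sub>R norm a - b /\<^sub>R norm b)"
proof -
  define u v where "u = a /\<^sub>R norm a" and "v = b /\<^sub>R norm b"
  have "0 < r" using a norm_ge_zero[of a] by linarith
  then have a0: "0 < norm a" using far by linarith
  have b0: "0 < norm b" using far by simp
  have u: "norm u = 1" "norm a *\<^sub>R u = a" and v: "norm v = 1" "norm b *\<^sub>R v = b"
    using a0 b0 by (auto simp: u_def v_def)
  show ?thesis
  proof (cases "norm b \<le> norm a")
    case True
    have "a - b = (norm a - norm b) *\<^sub>R u + norm b *\<^sub>R (u - v)"
      using u v by (simp add: algebra_simps)
    then have "norm (a - b) \<le> norm a - norm b + norm b * norm (u - v)"
      using norm_triangle_ineq[of "(norm a - norm b) *\<^sub>R u" "norm b *\<^sub>R (u - v)"] True u by simp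
    then have "norm b * 1 \<le> norm b * norm (u - v)" using a ab by linarith
    then have "1 \<le> norm (u - v)" using b0 by (simp del: mult_1_right)
    then show ?thesis unfolding u_def v_def by linarith
  next
    case False
    have "a - b = norm a *\<^sub>R (u - v) - (norm b - norm a) *\<^sub>R v"
      using u v by (simp add: algebra_simps)
    then have "norm (a - b) \<le> norm a * norm (u - v) + (norm b - norm a)"
      using norm_triangle_ineq4[of "norm a *\<^sub>R (u - v)" "(norm b - norm a) *\<^sub>R v"] False v by simp
    then have "norm a * (1/2) \<le> norm a * norm (u - v)" using b ab sr far by argo
    then have "1/2 \<le> norm (u - v)" using a0 by (simp only: mult_le_cancel_left_pos)
    then show ?thesis unfolding u_def v_def .
  qed
qed

text \<open>
  If \<open>p\<close> lies in many of the balls, then at most one of their centres is close to \<open>p\<close> relative to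
  its radius, and the other centres are seen from \<open>p\<close> in pairwise separated directions.
\<close>

lemma bounded_overlap:
  "\<exists>N. \<forall>(S :: 'a::euclidean_space set) r p.
     (\<forall>x\<in>S. 0 < r x) \<longrightarrow>
     (\<forall>x\<in>S. \<forall>y\<in>S. x \<noteq> y \<longrightarrow>
        r x \<le> dist x y \<and> r y \<le> 6/5 * r x \<or> r y \<le> dist x y \<and> r x \<le> 6/5 * r y) \<longrightarrow>
     finite {x\<in>S. p \<in> ball x (r x)} \<and> card {x\<in>S. p \<in> ball x (r x)} \<le> N"
proof -
  obtain N where "\<forall>(S :: 'a set) (u :: 'a \<Rightarrow> 'a).
     (\<forall>x\<in>S. norm (u x) = 1) \<longrightarrow> (\<forall>x\<in>S. \<forall>y\<in>S. x \<noteq> y \<longrightarrow> 1/2 \<le> dist (u x) (u y)) \<longrightarrow>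
     finite S \<and> card S \<le> N"
    using separated_directions_bounded ..
  note N = this[THEN spec, THEN spec, THEN mp, THEN mp]
  show ?thesis
  proof (intro exI allI impI)
    fix S :: "'a set" and r p
    assume pos: "\<forall>x\<in>S. 0 < r x"
      and sep: "\<forall>x\<in>S. \<forall>y\<in>S. x \<noteq> y \<longrightarrow>
        r x \<le> dist x y \<and> r y \<le> 6/5 * r x \<or> r y \<le> dist x y \<and> r x \<le> 6/5 * r y"
    define T where "T = {x\<in>S. p \<in> ball x (r x)}"
    define T0 where "T0 = {x\<in>T. norm (x - p) < 2/5 * r x}"
    define u where "u x = (x - p) /\<^sub>R norm (x - p)" for x
    have T: "norm (x - p) < r x" "x \<in> S" "0 < r x" if "x \<in> T" for x
      using that pos by (auto simp: T_def dist_norm)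
    have sep1: "1/2 \<le> dist (u x) (u y)"
      if "x \<in> T - T0" "y \<in> T - T0" "r x \<le> dist x y" "r y \<le> 6/5 * r x" for x y
      unfolding u_def dist_norm
    proof (rule directions_separated[of _ "r x" _ "r y"])
      show "r x \<le> norm (x - p - (y - p))" using that by (simp add: dist_norm)
      have "0 < 2/5 * r y" "2/5 * r y \<le> norm (y - p)" using that T[of y] by (auto simp: T0_def)
      then show "y - p \<noteq> 0" by fastforce
    qed (use that T in \<open>auto simp: T0_def\<close>)
    have "\<forall>x\<in>T - T0. norm (u x) = 1"
    proof
      fix x assume "x \<in> T - T0"
      then have "0 < 2/5 * r x" "2/5 * r x \<le> norm (x - p)" using T[of x] by (auto simp: T0_def)
      then have "0 < norm (x - p)" by linarith
      then show "norm (u x) = 1" by (simp add: u_def)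
    qed
    moreover have "\<forall>x\<in>T - T0. \<forall>y\<in>T - T0. x \<noteq> y \<longrightarrow> 1/2 \<le> dist (u x) (u y)"
    proof (intro ballI impI)
      fix x y assume xy: "x \<in> T - T0" "y \<in> T - T0" "x \<noteq> y"
      then have "x \<in> S" "y \<in> S" using T(2) by auto
      then consider "r x \<le> dist x y" "r y \<le> 6/5 * r x" | "r y \<le> dist y x" "r x \<le> 6/5 * r y"
        using sep[rule_format, of x y] xy(3) by (auto simp: dist_commute)
      then show "1/2 \<le> dist (u x) (u y)"
        using sep1[OF xy(1,2)] sep1[OF xy(2,1)] by cases (auto simp: dist_commute)
    qed
    ultimately have far: "finite (T - T0)" "card (T - T0) \<le> N" using N[of "T - T0" u] by auto
    \<comment> \<open>Two such centres would be less than 2/5 * (1 + 6/5) = 22/25 of one radius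
      apart, contradicting the separation by that radius.\<close>
    have "x = y" if "x \<in> T0" "y \<in> T0" for x y
    proof (rule ccontr)
      assume "x \<noteq> y"
      have tri: "dist x y \<le> norm (x - p) + norm (y - p)"
        using dist_triangle2[of x y p] by (simp add: dist_norm)
      have "x \<in> T" "y \<in> T" and less: "norm (x - p) < 2/5 * r x" "norm (y - p) < 2/5 * r y"
        using that by (auto simp: T0_def)
      then have pos: "0 < r x" "0 < r y"
        and "r x \<le> dist x y \<and> r y \<le> 6/5 * r x \<or> r y \<le> dist x y \<and> r x \<le> 6/5 * r y"
        using sep \<open>x \<noteq> y\<close> T by auto
      then show False using tri less by linarith
    qed
    then have "T0 = {} \<or> (\<exists>x. T0 = {x})" by blast
    then have near: "finite T0" "card T0 \<le> 1" by auto
    have "T = (T - T0) \<union> T0" by (auto simp: T0_def)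
    then have "finite T" "card T \<le> card (T - T0) + card T0"
      using far(1) near(1) card_Un_le[of "T - T0" T0] finite_UnI[of "T - T0" T0] by simp_all
    then show "finite {x\<in>S. p \<in> ball x (r x)} \<and> card {x\<in>S. p \<in> ball x (r x)} \<le> Suc N"
      using far near unfolding T_def[symmetric] by linarith
  qed
qed

text \<open>Transfinite greedy choice: an element is accepted if it is compatible, in the sense of
  \<open>Q\<close>, with every earlier accepted element. The recursive description is justified by
  well-founded recursion.\<close>

lemma wf_greedy_selection:
  assumes "wf R"
  obtains P where "\<And>x. P x \<longleftrightarrow> (\<forall>y. (y, x) \<in> R \<longrightarrow> P y \<longrightarrow> Q y x)"
proof -
  define P where "P = wfrec R (\<lambda>P x. \<forall>y. (y, x) \<in> R \<longrightarrow> P y \<longrightarrow> Q y x)"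
  have "P x \<longleftrightarrow> (\<forall>y. (y, x) \<in> R \<longrightarrow> P y \<longrightarrow> Q y x)" for x
    using wfrec[OF assms, of "\<lambda>P x. \<forall>y. (y, x) \<in> R \<longrightarrow> P y \<longrightarrow> Q y x" x]
    unfolding P_def cut_def by simp
  then show ?thesis using that by blast
qed

text \<open>Every member contains a point of a countable dense set, and each of these points lies in
  only finitely many members.\<close>

lemma countable_point_finite_open_family:
  fixes B :: "'b \<Rightarrow> 'a::second_countable_topology set"
  assumes "\<And>x. x \<in> S \<Longrightarrow> open (B x) \<and> B x \<noteq> {}" and "\<And>p. finite {x\<in>S. p \<in> B x}"
  shows "countable S"
proof -
  from countable_dense_setE
  obtain X :: "'a set" where X: "countable X" "\<And>Y. open Y \<Longrightarrow> Y \<noteq> {} \<Longrightarrow> \<exists>d\<in>X. d \<in> Y"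
    by auto
  have "S \<subseteq> (\<Union>d\<in>X. {x\<in>S. d \<in> B x})" 
  proof
    fix x assume x: "x \<in> S"
    then obtain d where "d \<in> X" "d \<in> B x" using X(2)[of "B x"] assms(1) by auto
    then show "x \<in> (\<Union>d\<in>X. {x\<in>S. d \<in> B x})" using x by blast
  qed
  moreover have "countable (\<Union>d\<in>X. {x\<in>S. d \<in> B x})"
    using X(1) countable_finite[OF assms(2)] by (rule countable_UN)
  ultimately show ?thesis by (rule countable_subset)
qed

text \<open>
  The centres are well-ordered so that the scale
  \<open>(5/6)\<^sup>k\<close> of the radius never increases, and a centre is selected if no earlier selected ball
  contains it.
\<close>

theorem besicovitch_covering:
  "\<exists>N. \<forall>(A :: 'a::euclidean_space set) r. (\<forall>x\<in>A. 0 < r x \<and> r x < 1) \<longrightarrow>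
     (\<exists>S\<subseteq>A. countable S \<and> A \<subseteq> (\<Union>x\<in>S. ball x (r x)) \<and>
       (\<forall>p. finite {x\<in>S. p \<in> ball x (r x)} \<and> card {x\<in>S. p \<in> ball x (r x)} \<le> N))"
proof -
  obtain N where "\<forall>(S :: 'a::euclidean_space set) r p.
     (\<forall>x\<in>S. 0 < r x) \<longrightarrow>
     (\<forall>x\<in>S. \<forall>y\<in>S. x \<noteq> y \<longrightarrow>
        r x \<le> dist x y \<and> r y \<le> 6/5 * r x \<or> r y \<le> dist x y \<and> r x \<le> 6/5 * r y) \<longrightarrow>
     finite {x\<in>S. p \<in> ball x (r x)} \<and> card {x\<in>S. p \<in> ball x (r x)} \<le> N"
    using bounded_overlap ..
  note N = this[THEN spec, THEN spec, THEN spec, THEN mp, THEN mp]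
  show ?thesis
  proof (rule exI[of _ N], intro allI impI)
    fix A :: "'a set" and r :: "'a \<Rightarrow> real"
    assume r: "\<forall>x\<in>A. 0 < r x \<and> r x < 1"
    \<comment> \<open>Real radii in decreasing order need not be well-ordered. Rounding to powers of
      5/6 gives a natural-number scale at the price of the factor 6/5 between radii.\<close>
    define k where "k x = (LEAST n. (5/6) ^ n \<le> r x)" for x
    have k_le: "(5/6) ^ k x \<le> r x" if "x \<in> A" for x
    proof -
      have "\<exists>n. (5/6 :: real) ^ n < r x" using r that by (intro real_arch_pow_inv) auto
      then have "\<exists>n. (5/6) ^ n \<le> r x" by (auto intro: less_imp_le)
      then show ?thesis unfolding k_def by (rule LeastI_ex)
    qed
    have k_gt: "r x < (6/5) * (5/6) ^ k x" if "x \<in> A" for x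
    proof (cases "k x")
      case 0
      then show ?thesis using r that by fastforce
    next
      case (Suc n)
      then have "\<not> (5/6) ^ n \<le> r x" unfolding k_def by (metis lessI not_less_Least)
      then show ?thesis by (simp add: Suc)
    qed
    have r_cmp: "r y \<le> 6/5 * r x" if "x \<in> A" "y \<in> A" "k x \<le> k y" for x y
    proof -
      have "(5/6 :: real) ^ k y \<le> (5/6) ^ k x" using that by (intro power_decreasing) auto
      then show ?thesis using k_gt[of y] k_le[of x] that by linarith
    qed
    \<comment> \<open>An arbitrary well-order of the space breaks ties between centres of the same
      scale.\<close>
    obtain W :: "'a rel" where W: "well_order_on UNIV W" using well_order_on by blast
    define R where "R = inv_image (less_than <*lex*> (W - Id)) (\<lambda>x. (k x, x))"
    have "wf R" unfolding R_def using W by (auto simp: well_order_on_def)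
    have R_total: "(x, y) \<in> R \<or> (y, x) \<in> R" if "x \<noteq> y" for x y
      using W that by (auto simp: R_def well_order_on_def linear_order_on_def total_on_def)
    have R_k: "k x \<le> k y" if "(x, y) \<in> R" for x y
      using that by (auto simp: R_def)
    obtain P where P: "\<And>x. P x \<longleftrightarrow> (\<forall>y. (y, x) \<in> R \<longrightarrow> P y \<longrightarrow> y \<in> A \<longrightarrow> r y \<le> dist y x)"
      by (rule wf_greedy_selection[OF \<open>wf R\<close>, of "\<lambda>y x. y \<in> A \<longrightarrow> r y \<le> dist y x"]) blast
    define S where "S = {x\<in>A. P x}"
    have "\<forall>x\<in>S. \<forall>y\<in>S. x \<noteq> y \<longrightarrow>
        r x \<le> dist x y \<and> r y \<le> 6/5 * r x \<or> r y \<le> dist x y \<and> r x \<le> 6/5 * r y"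
    proof (intro ballI impI)
      fix x y assume xy: "x \<in> S" "y \<in> S" "x \<noteq> y"
      then have A: "x \<in> A" "y \<in> A" "P x" "P y" by (auto simp: S_def)
      show "r x \<le> dist x y \<and> r y \<le> 6/5 * r x \<or> r y \<le> dist x y \<and> r x \<le> 6/5 * r y"
        using R_total[OF xy(3)]
      proof
        assume "(x, y) \<in> R"
        then show ?thesis using A P[of y] R_k r_cmp by blast
      next
        assume "(y, x) \<in> R"
        then show ?thesis using A P[of x] R_k r_cmp dist_commute[of x y] by simp
      qed
    qed
    then have N': "(\<forall>x\<in>S. 0 < r x) \<Longrightarrow> finite {x\<in>S. p \<in> ball x (r x)} \<and> card {x\<in>S. p \<in> ball x (r x)} \<le> N" for p
      by (rule N[rotated])
    have "\<forall>x\<in>S. 0 < r x" using r by (auto simp: S_def)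
    then have fin: "finite {x\<in>S. p \<in> ball x (r x)} \<and> card {x\<in>S. p \<in> ball x (r x)} \<le> N" for p
      by (rule N')
    have "countable S"
      using fin r by (intro countable_point_finite_open_family[of S "\<lambda>x. ball x (r x)"]) (auto simp: S_def)
    moreover have "A \<subseteq> (\<Union>x\<in>S. ball x (r x))"
    proof
      fix x assume x: "x \<in> A"
      show "x \<in> (\<Union>x\<in>S. ball x (r x))"
      proof (cases "P x")
        case True
        then show ?thesis using x r by (auto simp: S_def)
      next
        case False
        then obtain y where "P y" "y \<in> A" "\<not> r y \<le> dist y x" using P[of x] by blast
        then show ?thesis by (auto simp: S_def intro!: bexI[of _ y])
      qed
    qed
    ultimately show "\<exists>S\<subseteq>A. countable S \<and> A \<subseteq> (\<Union>x\<in>S. ball x (r x)) \<and>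
       (\<forall>p. finite {x\<in>S. p \<in> ball x (r x)} \<and> card {x\<in>S. p \<in> ball x (r x)} \<le> N)"
      using fin by (intro exI[of _ S]) (auto simp: S_def)
  qed
qed


section \<open>Differentiation of finite Borel measures\<close>

text \<open>The hypothesis is summed over the selected balls: they cover \<open>V\<close>, and they
  overlap at most \<open>N\<close> times inside \<open>U\<close>. The sums are integrals over
  counting measure, so that Tonelli exchanges them with \<open>\<mu>\<close>. The set
  \<open>A\<close> may be non-measurable, hence the open superset \<open>V\<close> in the
  conclusion.\<close>

lemma besicovitch_weak_type:
  fixes \<mu> :: "'a::euclidean_space measure"
  assumes sets [measurable_cong]: "sets \<mu> = sets borel"
  shows "\<exists>N :: nat. \<forall>A r D U c. D \<in> sets borel \<longrightarrow> U \<in> sets borel \<longrightarrow>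
      (\<forall>x\<in>A. 0 < r x \<and> r x < 1 \<and> ball x (r x) \<subseteq> U \<and>
         c * emeasure \<mu> (ball x (r x)) \<le> emeasure \<mu> (ball x (r x) \<inter> D)) \<longrightarrow>
      (\<exists>V. open V \<and> A \<subseteq> V \<and> c * emeasure \<mu> V \<le> of_nat N * emeasure \<mu> (U \<inter> D))"
proof -
  obtain N where "\<forall>(A :: 'a::euclidean_space set) r. (\<forall>x\<in>A. 0 < r x \<and> r x < 1) \<longrightarrow>
     (\<exists>S\<subseteq>A. countable S \<and> A \<subseteq> (\<Union>x\<in>S. ball x (r x)) \<and>
       (\<forall>p. finite {x\<in>S. p \<in> ball x (r x)} \<and> card {x\<in>S. p \<in> ball x (r x)} \<le> N))"
    using besicovitch_covering ..
  note N = this[THEN spec, THEN spec, THEN mp]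
  show ?thesis
  proof (rule exI[of _ N], intro allI impI)
    fix A r D U c
    assume [measurable]: "D \<in> sets borel" "U \<in> sets borel"
      and r: "\<forall>x\<in>A. 0 < r x \<and> r x < 1 \<and> ball x (r x) \<subseteq> U \<and>
         c * emeasure \<mu> (ball x (r x)) \<le> emeasure \<mu> (ball x (r x) \<inter> D)"
    from r have "\<forall>x\<in>A. 0 < r x \<and> r x < 1" by blast
    from N[OF this] obtain S where S: "S \<subseteq> A" "countable S" "A \<subseteq> (\<Union>x\<in>S. ball x (r x))"
      "\<And>p. finite {x\<in>S. p \<in> ball x (r x)}" "\<And>p. card {x\<in>S. p \<in> ball x (r x)} \<le> N"
      by blast
    have [measurable]: "ball x d \<in> sets \<mu>" for x d by (simp add: sets)
    define V where "V = (\<Union>x\<in>S. ball x (r x))"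
    have "open V" by (auto simp: V_def)
    then have [measurable]: "V \<in> sets borel" by simp
    have count: "(\<integral>\<^sup>+x. indicator (ball x (r x)) p \<partial>count_space S) = of_nat (card {x\<in>S. p \<in> ball x (r x)})" for p
    proof -
      have "(\<integral>\<^sup>+x. indicator (ball x (r x)) p \<partial>count_space S) =
          (\<integral>\<^sup>+x. indicator {x\<in>S. p \<in> ball x (r x)} x \<partial>count_space S)"
        by (intro nn_integral_cong) (auto split: split_indicator)
      also have "\<dots> = emeasure (count_space S) {x\<in>S. p \<in> ball x (r x)}"
        by (subst nn_integral_indicator) auto
      also have "\<dots> = of_nat (card {x\<in>S. p \<in> ball x (r x)})"
        using S(4)[of p] by (subst emeasure_count_space) auto
      finally show ?thesis .
    qed
    have ball_int: "(\<integral>\<^sup>+p. indicator (ball x (r x)) p * indicator (U \<inter> D) p \<partial>\<mu>) = emeasure \<mu> (ball x (r x) \<inter> D)"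
      if "x \<in> S" for x
    proof -
      have "ball x (r x) \<inter> (U \<inter> D) = ball x (r x) \<inter> D" using r S(1) that by blast
      then show ?thesis
        by (simp flip: indicator_inter_arith)
    qed
    have "emeasure \<mu> V = (\<integral>\<^sup>+p. indicator V p \<partial>\<mu>)" by simp
    also have "\<dots> \<le> (\<integral>\<^sup>+p. \<integral>\<^sup>+x. indicator (ball x (r x)) p \<partial>count_space S \<partial>\<mu>)"
    proof (intro nn_integral_mono)
      fix p
      show "indicator V p \<le> (\<integral>\<^sup>+x. indicator (ball x (r x)) p \<partial>count_space S)"
      proof (cases "p \<in> V")
        case True
        then have "{x\<in>S. p \<in> ball x (r x)} \<noteq> {}" by (auto simp: V_def)
        then have "1 \<le> card {x\<in>S. p \<in> ball x (r x)}"
          using S(4)[of p] by (simp add: Suc_le_eq card_gt_0_iff)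
        then show ?thesis unfolding count using True by (metis indicator_simps(1) of_nat_1 of_nat_mono)
      qed simp
    qed
    also have "\<dots> = (\<integral>\<^sup>+x. \<integral>\<^sup>+p. indicator (ball x (r x)) p \<partial>\<mu> \<partial>count_space S)"
      by (rule nn_integral_count_space_nn_integral[OF S(2)]) measurable
    also have "\<dots> = (\<integral>\<^sup>+x. emeasure \<mu> (ball x (r x)) \<partial>count_space S)"
      by (intro nn_integral_cong) simp
    finally have "c * emeasure \<mu> V \<le> c * (\<integral>\<^sup>+x. emeasure \<mu> (ball x (r x)) \<partial>count_space S)"
      by (rule mult_left_mono) simp
    also have "\<dots> = (\<integral>\<^sup>+x. c * emeasure \<mu> (ball x (r x)) \<partial>count_space S)"
      by (rule nn_integral_cmult[symmetric]) simp
    also have "\<dots> \<le> (\<integral>\<^sup>+x. \<integral>\<^sup>+p. indicator (ball x (r x)) p * indicator (U \<inter> D) p \<partial>\<mu> \<partial>count_space S)"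
      using r S(1) by (intro nn_integral_mono) (auto simp: ball_int)
    also have "\<dots> = (\<integral>\<^sup>+p. \<integral>\<^sup>+x. indicator (ball x (r x)) p * indicator (U \<inter> D) p \<partial>count_space S \<partial>\<mu>)"
      by (rule nn_integral_count_space_nn_integral[OF S(2), symmetric]) measurable
    also have "\<dots> = (\<integral>\<^sup>+p. of_nat (card {x\<in>S. p \<in> ball x (r x)}) * indicator (U \<inter> D) p \<partial>\<mu>)"
      by (simp add: nn_integral_multc count)
    also have "\<dots> \<le> (\<integral>\<^sup>+p. of_nat N * indicator (U \<inter> D) p \<partial>\<mu>)"
      using S(5) by (intro nn_integral_mono mult_right_mono of_nat_mono) auto
    also have "\<dots> = of_nat N * emeasure \<mu> (U \<inter> D)"
      by (subst nn_integral_cmult_indicator) auto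
    finally show "\<exists>V. open V \<and> A \<subseteq> V \<and> c * emeasure \<mu> V \<le> of_nat N * emeasure \<mu> (U \<inter> D)"
      using \<open>open V\<close> S(3) by (intro exI[of _ V]) (auto simp: V_def)
  qed
qed

text \<open>The exceptional points lie in an open \<open>U\<close> containing \<open>A\<close> with
  \<open>\<mu>(U - A)\<close> small, and the weak-type estimate with \<open>D = - A\<close> covers
  them by an open set of small measure. The strict inequality is deliberate: it forces the balls
  around \<open>x\<close> to have positive measure.\<close>

theorem AE_density_point:
  fixes \<mu> :: "'a::euclidean_space measure"
  assumes sets [measurable_cong]: "sets \<mu> = sets borel" and fin: "finite_measure \<mu>"
    and A [measurable]: "A \<in> sets borel"
  shows "AE x in \<mu>. x \<in> A \<longrightarrow>
    (\<forall>t>0. \<forall>\<^sub>F r in at_right 0. measure \<mu> (ball x r - A) < t * measure \<mu> (ball x r))"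
proof -
  interpret finite_measure \<mu> by fact
  have space: "space \<mu> = UNIV" using sets_eq_imp_space_eq[OF sets] by simp
  have AE_t: "AE x in \<mu>. x \<in> A \<longrightarrow>
    (\<forall>\<^sub>F r in at_right 0. measure \<mu> (ball x r - A) < t * measure \<mu> (ball x r))" if "0 < t" for t
  proof -
    define Z where "Z = {x\<in>A. \<not> (\<forall>\<^sub>F r in at_right 0. measure \<mu> (ball x r - A) < t * measure \<mu> (ball x r))}"
    obtain N :: nat where "\<forall>A r D U c. D \<in> sets borel \<longrightarrow> U \<in> sets borel \<longrightarrow>
      (\<forall>x\<in>A. 0 < r x \<and> r x < 1 \<and> ball x (r x) \<subseteq> U \<and>
         c * emeasure \<mu> (ball x (r x)) \<le> emeasure \<mu> (ball x (r x) \<inter> D)) \<longrightarrow>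
      (\<exists>V. open V \<and> A \<subseteq> V \<and> c * emeasure \<mu> V \<le> of_nat N * emeasure \<mu> (U \<inter> D))"
      using besicovitch_weak_type[OF sets] ..
    note N = this[THEN spec, THEN spec, THEN spec, THEN spec, THEN spec, THEN mp, THEN mp, THEN mp]
    have cover: "\<exists>V. open V \<and> Z \<subseteq> V \<and> measure \<mu> V \<le> \<eta>" if "0 < \<eta>" for \<eta>
    proof -
      \<comment> \<open>Chosen so that \<open>N * e \<le> t * \<eta>\<close>; adding 1 keeps the
        denominator non-zero when \<open>N\<close> is 0.\<close>
      define e where "e = t * \<eta> / (real N + 1)"
      have "0 < e" using \<open>0 < t\<close> \<open>0 < \<eta>\<close> by (simp add: e_def)
      have "emeasure \<mu> A < emeasure \<mu> A + ennreal e"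
        using \<open>0 < e\<close> by (simp add: less_top)
      then have "(INF U \<in> {U. A \<subseteq> U \<and> open U}. emeasure \<mu> U) < emeasure \<mu> A + ennreal e"
        using outer_regular[OF sets _ A] by simp
      then obtain U where U: "A \<subseteq> U" "open U" "emeasure \<mu> U < emeasure \<mu> A + ennreal e"
        unfolding INF_less_iff by blast
      have [measurable]: "U \<in> sets borel" using U by simp
      have "measure \<mu> U < measure \<mu> A + e"
        using U(3) \<open>0 < e\<close>
        by (simp add: emeasure_eq_measure ennreal_less_iff flip: ennreal_plus)
      moreover have "measure \<mu> (U - A) = measure \<mu> U - measure \<mu> A"
        using U(1) by (intro finite_measure_Diff) auto
      ultimately have UA: "measure \<mu> (U - A) < e" by linarith
      have "\<forall>x\<in>Z. \<exists>r. 0 < r \<and> r < 1 \<and> ball x r \<subseteq> U \<and> t * measure \<mu> (ball x r) \<le> measure \<mu> (ball x r - A)"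
      proof
        fix x assume x: "x \<in> Z"
        then have "x \<in> U" using U(1) by (auto simp: Z_def)
        then obtain d where d: "0 < d" "ball x d \<subseteq> U"
          using U(2) open_contains_ball by blast
        have "\<exists>r>0. r < min d 1 \<and> \<not> measure \<mu> (ball x r - A) < t * measure \<mu> (ball x r)"
          using x d(1) unfolding Z_def eventually_at_right_field by auto (metis min_less_iff_conj zero_less_one)
        then show "\<exists>r. 0 < r \<and> r < 1 \<and> ball x r \<subseteq> U \<and> t * measure \<mu> (ball x r) \<le> measure \<mu> (ball x r - A)"
          using d(2) by (metis less_imp_le min_less_iff_conj not_less subset_ball subset_trans)
      qed
      then obtain r where r: "\<And>x. x \<in> Z \<Longrightarrow> 0 < r x \<and> r x < 1 \<and> ball x (r x) \<subseteq> U \<and>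
          t * measure \<mu> (ball x (r x)) \<le> measure \<mu> (ball x (r x) - A)"
        by metis
      have "\<exists>V. open V \<and> Z \<subseteq> V \<and> ennreal t * emeasure \<mu> V \<le> of_nat N * emeasure \<mu> (U \<inter> - A)"
      proof (rule N[of "- A" U Z r])
        show "\<forall>x\<in>Z. 0 < r x \<and> r x < 1 \<and> ball x (r x) \<subseteq> U \<and>
          ennreal t * emeasure \<mu> (ball x (r x)) \<le> emeasure \<mu> (ball x (r x) \<inter> - A)"
          using r \<open>0 < t\<close>
          by (auto simp: emeasure_eq_measure Diff_eq ennreal_mult'[symmetric])
      qed auto
      then obtain V where V: "open V" "Z \<subseteq> V" "ennreal t * emeasure \<mu> V \<le> of_nat N * emeasure \<mu> (U - A)"
        by (auto simp: Diff_eq)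
      have "t * measure \<mu> V \<le> real N * measure \<mu> (U - A)"
        using V(3) \<open>0 < t\<close>
        by (simp add: emeasure_eq_measure ennreal_mult'[symmetric] flip: ennreal_of_nat_eq_real_of_nat)
           (simp add: ennreal_of_nat_eq_real_of_nat ennreal_mult'[symmetric])
      also have "\<dots> \<le> real N * e" using UA by (intro mult_left_mono) auto
      also have "\<dots> \<le> t * \<eta>" using \<open>0 < t\<close> \<open>0 < \<eta>\<close> by (simp add: e_def field_simps)
      finally have "measure \<mu> V \<le> \<eta>" using \<open>0 < t\<close> by simp
      then show ?thesis using V by blast
    qed
    have "\<exists>V. \<forall>m. open (V m) \<and> Z \<subseteq> V m \<and> measure \<mu> (V m) \<le> 1 / real (Suc m)"
      using cover by (intro choice allI) auto
    then obtain V where V: "\<And>m. open (V m)" "\<And>m. Z \<subseteq> V m" "\<And>m. measure \<mu> (V m) \<le> 1 / real (Suc m)"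
      by blast
    have [measurable]: "(\<Inter>m. V m) \<in> sets \<mu>" using V(1) by (auto simp: sets)
    have "measure \<mu> (\<Inter>m. V m) \<le> 1 / real (Suc m)" for m
      using V(1)[of m] by (intro order_trans[OF finite_measure_mono V(3)[of m]]) (auto simp: sets)
    then have "measure \<mu> (\<Inter>m. V m) = 0"
      using reals_Archimedean[of "measure \<mu> (\<Inter>m. V m)"]
      by (metis inverse_eq_divide measure_nonneg not_less less_eq_real_def)
    then have "(\<Inter>m. V m) \<in> null_sets \<mu>"
      by (intro null_setsI) (auto simp: emeasure_eq_measure)
    then show ?thesis
      by (rule AE_I') (use V(2) in \<open>auto simp: Z_def\<close>)
  qed
  have "AE x in \<mu>. \<forall>n. x \<in> A \<longrightarrow>
    (\<forall>\<^sub>F r in at_right 0. measure \<mu> (ball x r - A) < (1 / real (Suc n)) * measure \<mu> (ball x r))"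
    unfolding AE_all_countable by (intro allI AE_t) simp
  then show ?thesis
  proof (rule AE_mp, intro AE_I2 impI allI)
    fix x and t :: real
    assume ev: "\<forall>n. x \<in> A \<longrightarrow>
      (\<forall>\<^sub>F r in at_right 0. measure \<mu> (ball x r - A) < (1 / real (Suc n)) * measure \<mu> (ball x r))"
      and "x \<in> A" "0 < t"
    obtain n where n: "1 / real (Suc n) < t"
      using reals_Archimedean[OF \<open>0 < t\<close>] by (auto simp: inverse_eq_divide)
    from ev \<open>x \<in> A\<close> have "\<forall>\<^sub>F r in at_right 0. measure \<mu> (ball x r - A) < (1 / real (Suc n)) * measure \<mu> (ball x r)"
      by blast
    then show "\<forall>\<^sub>F r in at_right 0. measure \<mu> (ball x r - A) < t * measure \<mu> (ball x r)"
    proof eventually_elim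
      case (elim r)
      also have "1 / real (Suc n) * measure \<mu> (ball x r) \<le> t * measure \<mu> (ball x r)"
        using n by (intro mult_right_mono) auto
      finally show ?case .
    qed
  qed
qed

text \<open>The integrand is within \<open>e\<close> of \<open>v\<close> on \<open>A\<close> and
  within 2 of it elsewhere. It is applied with \<open>A\<close> of density one at the centre of
  \<open>B\<close>, so that the last term vanishes in the limit.\<close>

lemma (in finite_measure) norm_average_diff_le:
  fixes \<sigma> :: "'a \<Rightarrow> 'b::{banach, second_countable_topology}"
  assumes \<sigma> [measurable]: "\<sigma> \<in> borel_measurable M" and norm1: "AE x in M. norm (\<sigma> x) \<le> 1"
    and [measurable]: "B \<in> sets M" "A \<in> sets M" and pos: "0 < measure M B"
    and close: "\<And>x. x \<in> A \<Longrightarrow> norm (\<sigma> x - v) \<le> e" and v: "norm v \<le> 1" and "0 \<le> e"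
  shows "norm ((LINT x:B|M. \<sigma> x) /\<^sub>R measure M B - v) \<le> e + 2 * measure M (B - A) / measure M B"
proof -
  have int: "integrable M \<sigma>"
    using norm1 by (intro integrable_const_bound[of _ 1]) auto
  then have iB: "set_integrable M B \<sigma>" unfolding set_integrable_def
    by (intro integrable_mult_indicator) auto
  have iv: "set_integrable M B (\<lambda>x. v)"
    unfolding set_integrable_def by (intro integrable_mult_indicator) auto
  have "(LINT x:B|M. \<sigma> x - v) = (LINT x:B|M. \<sigma> x) - measure M B *\<^sub>R v"
    using set_integral_diff(2)[OF iB iv] by (simp add: set_integral_const)
  then have "norm ((LINT x:B|M. \<sigma> x) - measure M B *\<^sub>R v) = norm (LINT x|M. indicator B x *\<^sub>R (\<sigma> x - v))"
    by (simp add: set_lebesgue_integral_def)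
  also have "\<dots> \<le> (LINT x|M. norm (indicator B x *\<^sub>R (\<sigma> x - v)))"
    by (rule integral_norm_bound)
  also have "\<dots> \<le> (LINT x|M. e * indicator B x + 2 * indicator (B - A) x)"
  proof (rule integral_mono_AE)
    show "integrable M (\<lambda>x. norm (indicator B x *\<^sub>R (\<sigma> x - v)))"
      using int by (intro integrable_norm integrable_mult_indicator Bochner_Integration.integrable_diff) auto
    show "integrable M (\<lambda>x. e * indicator B x + 2 * indicator (B - A) x)"
      by (intro Bochner_Integration.integrable_add integrable_mult_right) (auto simp: integrable_indicator_iff less_top[symmetric])
    show "AE x in M. norm (indicator B x *\<^sub>R (\<sigma> x - v)) \<le> e * indicator B x + 2 * indicator (B - A) x"
      using norm1
    proof eventually_elim
      case (elim x)
      have "norm (\<sigma> x - v) \<le> 2" using norm_triangle_ineq4[of "\<sigma> x" v] elim v by linarith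
      then show ?case using close[of x] \<open>0 \<le> e\<close> by (auto split: split_indicator)
    qed
  qed
  also have "\<dots> = e * measure M B + 2 * measure M (B - A)"
    by (subst Bochner_Integration.integral_add) (auto simp: integrable_indicator_iff less_top[symmetric])
  finally have *: "norm ((LINT x:B|M. \<sigma> x) - measure M B *\<^sub>R v) \<le> e * measure M B + 2 * measure M (B - A)" .
  have "(LINT x:B|M. \<sigma> x) /\<^sub>R measure M B - v = ((LINT x:B|M. \<sigma> x) - measure M B *\<^sub>R v) /\<^sub>R measure M B"
    using pos by (simp add: algebra_simps)
  then have "norm ((LINT x:B|M. \<sigma> x) /\<^sub>R measure M B - v) = norm ((LINT x:B|M. \<sigma> x) - measure M B *\<^sub>R v) / measure M B"
    using pos by (simp add: divide_inverse_commute)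
  also have "\<dots> \<le> (e * measure M B + 2 * measure M (B - A)) / measure M B"
    using * pos by (intro divide_right_mono) auto
  also have "\<dots> = e + 2 * measure M (B - A) / measure M B"
    using pos by (simp add: field_simps)
  finally show ?thesis .
qed

text \<open>Separability of the codomain reduces the claim to countably many applications of the
  density theorem, to the preimages of small balls centred in a countable dense set. Almost every
  point is a density point of all of these preimages that contain it.\<close>

theorem AE_lebesgue_besicovitch:
  fixes \<mu> :: "'a::euclidean_space measure" and \<sigma> :: "'a \<Rightarrow> 'b::{banach, second_countable_topology}"
  assumes sets [measurable_cong]: "sets \<mu> = sets borel" and fin: "finite_measure \<mu>"
    and \<sigma> [measurable]: "\<sigma> \<in> borel_measurable borel" and norm1: "AE x in \<mu>. norm (\<sigma> x) \<le> 1"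
  shows "AE x in \<mu>. (\<forall>r>0. 0 < measure \<mu> (ball x r)) \<and>
    ((\<lambda>r. (LINT y:ball x r|\<mu>. \<sigma> y) /\<^sub>R measure \<mu> (ball x r)) \<longlongrightarrow> \<sigma> x) (at_right 0)"
proof -
  interpret finite_measure \<mu> by fact
  obtain X :: "'b set" where X: "countable X" "\<forall>Y. open Y \<longrightarrow> Y \<noteq> {} \<longrightarrow> (\<exists>d\<in>X. d \<in> Y)"
    using countable_dense_exists by metis
  define A where "A c n = \<sigma> -` ball c (1 / real (Suc n))" for c n
  have A [measurable]: "A c n \<in> sets borel" for c n
    using measurable_sets_borel[OF \<sigma>, of "ball c (1 / real (Suc n))"] by (simp add: A_def)
  have "AE x in \<mu>. \<forall>c\<in>X. \<forall>n. x \<in> A c n \<longrightarrow>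
    (\<forall>t>0. \<forall>\<^sub>F r in at_right 0. measure \<mu> (ball x r - A c n) < t * measure \<mu> (ball x r))"
    using X(1) by (subst AE_ball_countable) (auto simp: AE_all_countable intro!: AE_density_point[OF sets fin A])
  then show ?thesis using norm1
  proof eventually_elim
    case (elim x)
    have dens: "\<exists>c n. x \<in> A c n \<and> 2 / real (Suc n) < e \<and>
        (\<forall>t>0. \<forall>\<^sub>F r in at_right 0. measure \<mu> (ball x r - A c n) < t * measure \<mu> (ball x r))" if "0 < e" for e
    proof -
      obtain n where n: "1 / real (Suc n) < e / 2"
        using reals_Archimedean[of "e / 2"] \<open>0 < e\<close> by (auto simp: inverse_eq_divide)
      obtain c where "c \<in> X" "c \<in> ball (\<sigma> x) (1 / real (Suc n))"
        using X(2)[rule_format, of "ball (\<sigma> x) (1 / real (Suc n))"] by auto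
      moreover from this have "x \<in> A c n" by (auto simp: A_def dist_commute)
      ultimately show ?thesis using elim(1) n by (intro exI[of _ c] exI[of _ n]) auto
    qed
    \<comment> \<open>The strict density inequality with \<open>t = 1\<close> gives positive measure
      for some smaller ball, and monotonicity passes it to \<open>r\<close>.\<close>
    have pos: "0 < measure \<mu> (ball x r)" if "0 < r" for r
    proof -
      obtain c n where "\<forall>\<^sub>F r in at_right 0. measure \<mu> (ball x r - A c n) < 1 * measure \<mu> (ball x r)"
        using dens[of 1] by (meson zero_less_one)
      moreover have "\<forall>\<^sub>F s in at_right 0. s < r"
        using that by (auto simp: eventually_at_right_field)
      ultimately have "\<forall>\<^sub>F s in at_right 0. 0 < measure \<mu> (ball x s) \<and> s < r"
        by eventually_elim (auto intro: le_less_trans[OF measure_nonneg])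
      then obtain s where "0 < measure \<mu> (ball x s)" "s < r"
        using eventually_happens trivial_limit_at_right_real by blast
      then show ?thesis
        using finite_measure_mono[of "ball x s" "ball x r"] subset_ball[of s r x] by (simp add: sets)
    qed
    moreover have "((\<lambda>r. (LINT y:ball x r|\<mu>. \<sigma> y) /\<^sub>R measure \<mu> (ball x r)) \<longlongrightarrow> \<sigma> x) (at_right 0)"
    proof (rule tendstoI)
      fix e :: real assume "0 < e"
      obtain c n where cn: "x \<in> A c n" "2 / real (Suc n) < e / 2"
        and ev: "\<forall>t>0. \<forall>\<^sub>F r in at_right 0. measure \<mu> (ball x r - A c n) < t * measure \<mu> (ball x r)"
        using dens[of "e / 2"] \<open>0 < e\<close> by (meson half_gt_zero)
      have close: "norm (\<sigma> y - \<sigma> x) \<le> 2 / real (Suc n)" if "y \<in> A c n" for y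
      proof -
        have "dist (\<sigma> y) (\<sigma> x) \<le> dist c (\<sigma> y) + dist c (\<sigma> x)" by (rule dist_triangle3)
        then show ?thesis using cn(1) that by (auto simp: A_def dist_norm[symmetric])
      qed
      have "\<forall>\<^sub>F r in at_right 0. measure \<mu> (ball x r - A c n) < e / 4 * measure \<mu> (ball x r)"
        using ev[rule_format, of "e / 4"] \<open>0 < e\<close> by simp
      moreover have "\<forall>\<^sub>F r in at_right 0. (0::real) < r" by (rule eventually_at_right_less)
      ultimately show "\<forall>\<^sub>F r in at_right 0. dist ((LINT y:ball x r|\<mu>. \<sigma> y) /\<^sub>R measure \<mu> (ball x r)) (\<sigma> x) < e"
      proof eventually_elim
        case (elim r)
        have "norm ((LINT y:ball x r|\<mu>. \<sigma> y) /\<^sub>R measure \<mu> (ball x r) - \<sigma> x)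
            \<le> 2 / real (Suc n) + 2 * measure \<mu> (ball x r - A c n) / measure \<mu> (ball x r)"
          using norm1 close pos elim \<open>norm (\<sigma> x) \<le> 1\<close>
          by (intro norm_average_diff_le) (auto simp: sets)
        also have "\<dots> < e / 2 + e / 2"
          using elim pos[of r] cn(2) by (intro add_strict_mono) (auto simp: field_simps)
        finally show ?case by (simp add: dist_norm)
      qed
    qed
    ultimately show ?case by blast
  qed
qed


section \<open>Test fields for the Gauss-Green formula\<close>

text \<open>Squaring smooths the corner at 0, where the difference quotient is
  \<open>max 0 h\<close>. This yields C1 cut-off functions that are explicit piecewise
  polynomials.\<close>

lemma has_real_derivative_max_0_square:
  "((\<lambda>t::real. (max 0 t)\<^sup>2) has_real_derivative 2 * max 0 t) (at t)"
proof (cases t "0::real" rule: linorder_cases)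
  case less
  have "((\<lambda>t::real. 0) has_real_derivative 2 * max 0 t) (at t)"
    using less by (auto intro!: derivative_eq_intros)
  then show ?thesis
    by (rule has_field_derivative_transform_within_open[of _ _ _ "{..<0}"]) (use less in auto)
next
  case equal
  have lim: "((\<lambda>h::real. max 0 h) \<longlongrightarrow> max 0 0) (at 0)" by (intro tendsto_intros)
  have "((\<lambda>h::real. ((max 0 (0 + h))\<^sup>2 - (max 0 0)\<^sup>2) / h) \<longlongrightarrow> 0) (at 0)"
    by (rule Lim_transform_eventually[OF lim[simplified]])
       (auto simp: max_def power2_eq_square intro!: always_eventually)
  then show ?thesis using equal by (simp add: DERIV_def)
next
  case greater
  have "((\<lambda>t::real. t\<^sup>2) has_real_derivative 2 * max 0 t) (at t)"
    using greater by (auto intro!: derivative_eq_intros)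
  then show ?thesis
    by (rule has_field_derivative_transform_within_open[of _ _ _ "{0<..}"]) (use greater in auto)
qed

lemma borel_measurable_vec_nth [measurable]:
  fixes f :: "'a \<Rightarrow> real ^ 'n"
  assumes "f \<in> borel_measurable M"
  shows "(\<lambda>x. f x $ i) \<in> borel_measurable M"
proof -
  have "(\<lambda>x. f x \<bullet> axis i 1) \<in> borel_measurable M" using assms by measurable
  then show ?thesis by (simp add: inner_axis)
qed

text \<open>The cut-off profile. It vanishes off \<open>ball c L\<close>, and its square is C1 with
  an explicit gradient.\<close>

definition paraboloid :: "real^2 \<Rightarrow> real \<Rightarrow> real^2 \<Rightarrow> real" where
  "paraboloid c L y = max 0 (1 - ((y - c) \<bullet> (y - c)) / L\<^sup>2)"

text \<open>One family serves both tests: \<open>u = axis 1 1\<close>, \<open>v = 0\<close>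
  truncates the field \<open>(y\<^sub>1, 0)\<close>, while \<open>u = 0\<close> truncates the
  constant field \<open>v\<close>.\<close>

definition bump_field :: "real^2 \<Rightarrow> real \<Rightarrow> real^2 \<Rightarrow> real^2 \<Rightarrow> real^2 \<Rightarrow> real^2" where
  "bump_field c L u v y = (paraboloid c L y)\<^sup>2 *\<^sub>R (v + (y $ 1) *\<^sub>R u)"

lemma paraboloid_nonneg: "0 \<le> paraboloid c L y" and paraboloid_le_1: "paraboloid c L y \<le> 1"
  by (auto simp: paraboloid_def)

lemma paraboloid_eq_0: "0 < L \<Longrightarrow> y \<notin> ball c L \<Longrightarrow> paraboloid c L y = 0"
proof -
  assume L: "0 < L" and "y \<notin> ball c L"
  then have "L \<le> norm (y - c)" by (simp add: dist_norm norm_minus_commute)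
  then have "L\<^sup>2 \<le> (y - c) \<bullet> (y - c)"
    using L by (simp add: power_mono flip: power2_norm_eq_inner)
  then show ?thesis using L by (simp add: paraboloid_def field_simps)
qed

lemma paraboloid_ge:
  assumes "0 < r" "y \<in> ball c r" "r \<le> L"
  shows "1 - (r / L)\<^sup>2 \<le> paraboloid c L y"
proof -
  have "norm (y - c) \<le> r" using assms by (simp add: dist_norm norm_minus_commute)
  then have "(y - c) \<bullet> (y - c) \<le> r\<^sup>2" using assms
    by (simp add: power_mono flip: power2_norm_eq_inner)
  then have "((y - c) \<bullet> (y - c)) / L\<^sup>2 \<le> (r / L)\<^sup>2"
    by (simp add: power_divide divide_right_mono)
  then show ?thesis unfolding paraboloid_def by linarith
qed

lemma continuous_on_paraboloid [continuous_intros]: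
  assumes "continuous_on S f" shows "continuous_on S (\<lambda>y. paraboloid c L (f y))"
  unfolding paraboloid_def divide_inverse by (intro continuous_intros assms)

lemma has_derivative_paraboloid_square:
  "((\<lambda>y. (paraboloid c L y)\<^sup>2) has_derivative (\<lambda>h. - (4 * paraboloid c L y / L\<^sup>2) * ((y - c) \<bullet> h))) (at y)"
proof -
  have 1: "((\<lambda>y. 1 - ((y - c) \<bullet> (y - c)) / L\<^sup>2) has_derivative (\<lambda>h. - (2 * ((y - c) \<bullet> h)) / L\<^sup>2)) (at y)"
    unfolding divide_inverse by (auto intro!: derivative_eq_intros simp: inner_commute algebra_simps)
  have 2: "((\<lambda>t::real. (max 0 t)\<^sup>2) has_derivative (\<lambda>h. 2 * paraboloid c L y * h))
      (at (1 - ((y - c) \<bullet> (y - c)) / L\<^sup>2))"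
    using has_real_derivative_max_0_square unfolding has_field_derivative_def paraboloid_def .
  show ?thesis
    using diff_chain_at[OF 1 2] by (simp add: o_def paraboloid_def mult.assoc)
qed

lemma has_derivative_bump_field:
  "(bump_field c L u v has_derivative
     (\<lambda>h. (- (4 * paraboloid c L y / L\<^sup>2) * ((y - c) \<bullet> h)) *\<^sub>R (v + (y $ 1) *\<^sub>R u) + (paraboloid c L y)\<^sup>2 *\<^sub>R ((h $ 1) *\<^sub>R u))) (at y)"
proof -
  have "((\<lambda>y. v + (y $ 1) *\<^sub>R u) has_derivative (\<lambda>h. (h $ 1) *\<^sub>R u)) (at y)"
    by (auto intro!: derivative_eq_intros bounded_linear_imp_has_derivative bounded_linear_vec_nth)
  from has_derivative_scaleR[OF has_derivative_paraboloid_square this]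
  show ?thesis
    unfolding bump_field_def[abs_def] by (simp add: add.commute)
qed

lemma frechet_derivative_bump_field:
  "frechet_derivative (bump_field c L u v) (at y) h =
     (- (4 * paraboloid c L y / L\<^sup>2) * ((y - c) \<bullet> h)) *\<^sub>R (v + (y $ 1) *\<^sub>R u) + (paraboloid c L y)\<^sup>2 *\<^sub>R ((h $ 1) *\<^sub>R u)"
  by (rule fun_cong[OF frechet_derivative_at[OF has_derivative_bump_field, symmetric]])

lemma C1_compact_support_bump_field:
  assumes "0 < L"
  shows "C1_compact_support (bump_field c L u v)"
  unfolding C1_compact_support_def
proof (intro conjI allI)
  show "bump_field c L u v differentiable at x" for x
    using has_derivative_bump_field by (blast intro: differentiableI)
  show "continuous_on UNIV (\<lambda>x. frechet_derivative (bump_field c L u v) (at x) h)" for h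
    unfolding frechet_derivative_bump_field divide_inverse by (intro continuous_intros)
  have "{x. bump_field c L u v x \<noteq> 0} \<subseteq> ball c L"
    using paraboloid_eq_0[OF assms] by (auto simp: bump_field_def simp del: mem_ball)
  then show "compact (closure {x. bump_field c L u v x \<noteq> 0})"
    using bounded_subset[OF bounded_ball] compact_closure by blast
qed

lemma divergence_bump_field:
  "divergence (bump_field c L u v) y =
     - (4 * paraboloid c L y / L\<^sup>2) * ((y - c) \<bullet> (v + (y $ 1) *\<^sub>R u)) + (paraboloid c L y)\<^sup>2 * u $ 1"
proof -
  define a w where "a = - (4 * paraboloid c L y / L\<^sup>2)" and "w = v + (y $ 1) *\<^sub>R u"
  have "divergence (bump_field c L u v) y =
     (\<Sum>i\<in>UNIV. a * ((y - c) $ i * w $ i) + (paraboloid c L y)\<^sup>2 * ((axis i 1 :: real^2) $ 1 * u $ i))"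
    unfolding divergence_def frechet_derivative_bump_field a_def[symmetric] w_def[symmetric]
    by (simp add: inner_axis mult.assoc)
  also have "\<dots> = a * ((y - c) \<bullet> w) + (paraboloid c L y)\<^sup>2 * u $ 1"
    by (simp add: inner_vec_def sum_2 axis_def algebra_simps)
  finally show ?thesis unfolding a_def w_def .
qed

lemma continuous_on_bump_field: "continuous_on S (bump_field c L u v)"
  unfolding bump_field_def[abs_def] by (intro continuous_intros)

lemma continuous_on_divergence_bump_field: "continuous_on S (divergence (bump_field c L u v))"
  unfolding divergence_bump_field[abs_def] divide_inverse by (intro continuous_intros)

lemma gauss_green_bump_field:
  assumes "gauss_green E (\<mu>, \<sigma>)" "0 < L"
  shows "(LINT x:E|lborel. divergence (bump_field c L u v) x) = (LINT x|\<mu>. bump_field c L u v x \<bullet> \<sigma> x)"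
  using assms C1_compact_support_bump_field by (auto simp: gauss_green_def)

text \<open>The test field is parallel to the first axis, so only \<open>\<sigma> x $ 1\<close>
  enters the flux. Its divergence is at least 1/2 on \<open>E\<close> and its length at most
  \<open>4 * R\<close>, whence the factor 8.\<close>

lemma area_le_directional_perimeter:
  assumes gg: "gauss_green E (\<mu>, \<sigma>)" and E [measurable]: "E \<in> sets borel"
    and "E \<subseteq> ball 0 R" "0 < R"
  shows "emeasure lborel E \<le> ennreal (8 * R) * (\<integral>\<^sup>+x. ennreal \<bar>\<sigma> x $ 1\<bar> \<partial>\<mu>)"
proof -
  have sets [measurable_cong]: "sets \<mu> = sets borel" and fin: "finite_measure \<mu>"
    and \<sigma> [measurable]: "\<sigma> \<in> borel_measurable borel" and norm1: "AE x in \<mu>. norm (\<sigma> x) = 1"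
    using gg by (auto simp: gauss_green_def)
  interpret finite_measure \<mu> by fact
  define \<phi> where "\<phi> = bump_field 0 (4 * R) (axis 1 1) 0"
  have [measurable]: "divergence \<phi> \<in> borel_measurable borel" "\<phi> \<in> borel_measurable borel"
    unfolding \<phi>_def
    by (intro borel_measurable_continuous_onI continuous_on_divergence_bump_field continuous_on_bump_field)+
  have "emeasure lborel E \<le> emeasure lborel (ball (0::real^2) R)"
    using assms(3) by (intro emeasure_mono) auto
  also have "\<dots> < \<infinity>" by (rule emeasure_bounded_finite) simp
  finally have fin_E: "emeasure lborel E < \<infinity>" .
  \<comment> \<open>The cut-off radius \<open>4 * R\<close> is large compared with \<open>E\<close>:
    the cut-off term costs at most 1/4, leaving at least (15/16)^2 - 1/4, which exceeds 1/2.\<close>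
  have div: "1 / 2 \<le> divergence \<phi> y \<and> divergence \<phi> y \<le> 1" if "y \<in> E" for y
  proof -
    define m where "m = paraboloid 0 (4 * R) y"
    have m: "15 / 16 \<le> m" "m \<le> 1"
      using paraboloid_ge[of R y 0 "4 * R"] that assms paraboloid_le_1 by (auto simp: m_def power2_eq_square)
    have "\<bar>y $ 1\<bar> \<le> norm y" by (rule component_le_norm_cart)
    moreover have "norm y < R" using that assms by auto
    ultimately have "(y $ 1)\<^sup>2 \<le> R\<^sup>2" by (intro power2_le_iff_abs_le[THEN iffD2]) (use \<open>0 < R\<close> in auto)
    then have q: "0 \<le> (y $ 1)\<^sup>2 / R\<^sup>2" "(y $ 1)\<^sup>2 / R\<^sup>2 \<le> 1" using \<open>0 < R\<close> by auto
    have "divergence \<phi> y = m\<^sup>2 - m / 4 * ((y $ 1)\<^sup>2 / R\<^sup>2)"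
      using \<open>0 < R\<close> by (simp add: \<phi>_def divergence_bump_field m_def[symmetric] inner_axis power2_eq_square)
    moreover have "m / 4 * ((y $ 1)\<^sup>2 / R\<^sup>2) \<le> 1 / 4 * 1"
      using m q by (intro mult_mono) auto
    moreover have "0 \<le> m / 4 * ((y $ 1)\<^sup>2 / R\<^sup>2)" using m q by (intro mult_nonneg_nonneg) auto
    moreover have "(15 / 16)\<^sup>2 \<le> m\<^sup>2" "m\<^sup>2 \<le> 1" using m by (auto intro: power_mono power_le_one)
    ultimately show ?thesis by (simp add: power2_eq_square)
  qed
  have "measure lborel E / 2 = (LINT x:E|lborel. 1 / 2)"
    using fin_E by (subst set_integral_const) (auto simp: E)
  also have "\<dots> \<le> (LINT x:E|lborel. divergence \<phi> x)"
  proof (rule set_integral_mono)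
    show "set_integrable lborel E (\<lambda>_. 1 / 2 :: real)"
      using fin_E by (auto simp: set_integrable_def)
    show "set_integrable lborel E (divergence \<phi>)"
      unfolding set_integrable_def
      by (rule integrableI_bounded_set[where A = E and B = 1])
         (use fin_E div in \<open>force split: split_indicator\<close>)+
  qed (use div in auto)
  also have "\<dots> = (LINT x|\<mu>. \<phi> x \<bullet> \<sigma> x)"
    unfolding \<phi>_def using gg \<open>0 < R\<close> by (intro gauss_green_bump_field) auto
  also have "\<dots> \<le> (LINT x|\<mu>. 4 * R * \<bar>\<sigma> x $ 1\<bar>)"
  proof (rule integral_mono_AE')
    show "integrable \<mu> (\<lambda>x. 4 * R * \<bar>\<sigma> x $ 1\<bar>)"
    proof (rule integrable_const_bound[where B = "4 * R"])
      show "AE x in \<mu>. norm (4 * R * \<bar>\<sigma> x $ 1\<bar>) \<le> 4 * R"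
        using norm1
      proof eventually_elim
        case (elim x)
        then show ?case using component_le_norm_cart[of "\<sigma> x" 1] \<open>0 < R\<close> by (simp add: abs_mult)
      qed
    qed simp
    show "AE x in \<mu>. \<phi> x \<bullet> \<sigma> x \<le> 4 * R * \<bar>\<sigma> x $ 1\<bar>"
    proof (rule AE_I2)
      fix x
      have "\<phi> x \<bullet> \<sigma> x = (paraboloid 0 (4 * R) x)\<^sup>2 * x $ 1 * \<sigma> x $ 1"
        by (simp add: \<phi>_def bump_field_def inner_axis')
      also have "\<dots> \<le> \<bar>(paraboloid 0 (4 * R) x)\<^sup>2 * x $ 1\<bar> * \<bar>\<sigma> x $ 1\<bar>"
        by (metis abs_ge_self abs_mult)
      also have "\<bar>(paraboloid 0 (4 * R) x)\<^sup>2 * x $ 1\<bar> \<le> 4 * R"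
      proof (cases "x \<in> ball 0 (4 * R)")
        case True
        then have "\<bar>x $ 1\<bar> \<le> 4 * R" using component_le_norm_cart[of x 1] by auto
        moreover have "(paraboloid 0 (4 * R) x)\<^sup>2 \<le> 1"
          using paraboloid_nonneg paraboloid_le_1 by (rule power_le_one)
        ultimately show ?thesis
          using mult_mono[of "(paraboloid 0 (4 * R) x)\<^sup>2" 1 "\<bar>x $ 1\<bar>" "4 * R"] by (simp add: abs_mult)
      next
        case False
        then show ?thesis using paraboloid_eq_0[of "4 * R" x 0] \<open>0 < R\<close> by simp
      qed
      finally show "\<phi> x \<bullet> \<sigma> x \<le> 4 * R * \<bar>\<sigma> x $ 1\<bar>" by (simp add: mult_right_mono)
    qed
  qed (use \<open>0 < R\<close> in auto)
  finally have "measure lborel E \<le> 2 * (LINT x|\<mu>. 4 * R * \<bar>\<sigma> x $ 1\<bar>)" by simp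
  then have "measure lborel E \<le> 8 * R * (LINT x|\<mu>. \<bar>\<sigma> x $ 1\<bar>)" by simp
  then have "emeasure lborel E \<le> ennreal (8 * R * (LINT x|\<mu>. \<bar>\<sigma> x $ 1\<bar>))"
    using fin_E by (simp add: emeasure_eq_ennreal_measure ennreal_leI less_top)
  also have "\<dots> = ennreal (8 * R) * ennreal (LINT x|\<mu>. \<bar>\<sigma> x $ 1\<bar>)"
    using \<open>0 < R\<close> by (intro ennreal_mult) auto
  also have "ennreal (LINT x|\<mu>. \<bar>\<sigma> x $ 1\<bar>) \<le> (\<integral>\<^sup>+x. ennreal \<bar>\<sigma> x $ 1\<bar> \<partial>\<mu>)"
  proof (subst nn_integral_eq_integral)
    have "AE x in \<mu>. norm \<bar>\<sigma> x $ 1\<bar> \<le> 1"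
      using norm1
    proof eventually_elim
      case (elim x)
      then show ?case using component_le_norm_cart[of "\<sigma> x" 1] by simp
    qed
    then show "integrable \<mu> (\<lambda>x. \<bar>\<sigma> x $ 1\<bar>)" by (rule integrable_const_bound) simp
  qed auto
  finally show ?thesis by (simp add: mult_left_mono)
qed

section \<open>Linear growth of the perimeter measure where an average normal exists\<close>

text \<open>
  Testing with a bump times \<open>\<nu>\<close> bounds the flux by a multiple of \<open>r\<close>, and this flux controls
  the mass of the small ball up to the defect of the average normal on the large ball.
\<close>

lemma perimeter_doubling_estimate:
  assumes gg: "gauss_green E (\<mu>, \<sigma>)" and E [measurable]: "E \<in> sets borel"
    and \<nu>: "norm \<nu> = 1" and "0 < r"
    and mean: "55 / 64 \<le> \<nu> \<bullet> ((LINT y:ball x (2 * r)|\<mu>. \<sigma> y) /\<^sub>R measure \<mu> (ball x (2 * r)))"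
  shows "measure \<mu> (ball x r) \<le> 57 * r + measure \<mu> (ball x (2 * r)) / 4"
proof -
  have sets [measurable_cong]: "sets \<mu> = sets borel" and fin: "finite_measure \<mu>"
    and \<sigma> [measurable]: "\<sigma> \<in> borel_measurable borel" and norm1: "AE x in \<mu>. norm (\<sigma> x) = 1"
    using gg by (auto simp: gauss_green_def)
  interpret finite_measure \<mu> by fact
  have [measurable]: "ball x s \<in> sets \<mu>" for s by (simp add: sets)
  have [measurable]: "ball x s \<in> sets borel" for s by simp
  define \<phi> where "\<phi> = bump_field x (2 * r) 0 \<nu>"
  have [measurable]: "divergence \<phi> \<in> borel_measurable borel" "\<phi> \<in> borel_measurable borel"
    unfolding \<phi>_def
    by (intro borel_measurable_continuous_onI continuous_on_divergence_bump_field continuous_on_bump_field)+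
  let ?B = "ball x (2 * r)"
  have fin_B: "emeasure lborel ?B < \<infinity>" by (rule emeasure_bounded_finite) simp
  \<comment> \<open>The gradient of the cut-off has size at most \<open>2 / r\<close>. Integrated
    over a disc of area \<open>4 * pi * r^2\<close> this gives \<open>8 * pi * r\<close>, rounded up
    to \<open>32 * r\<close> by \<open>pi < 4\<close>.\<close>
  have div: "\<bar>divergence \<phi> y\<bar> \<le> 2 / r * indicator ?B y" for y
  proof (cases "y \<in> ?B")
    case True
    have "\<bar>divergence \<phi> y\<bar> = paraboloid x (2 * r) y / r\<^sup>2 * \<bar>(y - x) \<bullet> \<nu>\<bar>"
      using paraboloid_nonneg[of x "2 * r" y]
      by (simp add: \<phi>_def divergence_bump_field abs_mult power2_eq_square)
    also have "\<dots> \<le> 1 / r\<^sup>2 * (2 * r)"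
    proof (intro mult_mono divide_right_mono paraboloid_le_1)
      have "\<bar>(y - x) \<bullet> \<nu>\<bar> \<le> norm (y - x)" using Cauchy_Schwarz_ineq2[of "y - x" \<nu>] \<nu> by simp
      also have "\<dots> \<le> 2 * r" using True by (simp add: dist_norm norm_minus_commute)
      finally show "\<bar>(y - x) \<bullet> \<nu>\<bar> \<le> 2 * r" .
    qed auto
    finally show ?thesis using True \<open>0 < r\<close> by (simp add: power2_eq_square)
  next
    case False
    then show ?thesis
      using paraboloid_eq_0[of "2 * r" y x] \<open>0 < r\<close> by (simp add: \<phi>_def divergence_bump_field)
  qed
  have "(LINT y:E|lborel. divergence \<phi> y) \<le> (LINT y|lborel. 2 / r * indicator ?B y)"
    unfolding set_lebesgue_integral_def
  proof (rule integral_mono')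
    show "integrable lborel (\<lambda>y. 2 / r * indicator ?B y :: real)"
      using fin_B by (intro integrable_mult_right) (auto simp: integrable_indicator_iff)
    show "indicat_real E y *\<^sub>R divergence \<phi> y \<le> 2 / r * indicator ?B y" for y
      using div[of y] \<open>0 < r\<close> by (auto split: split_indicator)
  qed (use \<open>0 < r\<close> in auto)
  also have "\<dots> = 2 / r * measure lborel ?B" by simp
  also have "measure lborel ?B = pi * (2 * r)\<^sup>2"
    using content_ball[of "2 * r" x] \<open>0 < r\<close> by (simp add: unit_ball_vol_2)
  also have "2 / r * (pi * (2 * r)\<^sup>2) = 8 * pi * r"
    using \<open>0 < r\<close> by (simp add: power2_eq_square)
  also have "\<dots> \<le> 32 * r" using pi_less_4 \<open>0 < r\<close> by simp
  finally have upper: "(LINT y|\<mu>. \<phi> y \<bullet> \<sigma> y) \<le> 32 * r"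
    using gauss_green_bump_field[OF gg, of "2 * r" x 0 \<nu>] \<open>0 < r\<close> by (simp add: \<phi>_def)
  have int: "integrable \<mu> \<sigma>"
    using norm1 by (intro integrable_const_bound[of _ 1]) auto
  have int_B: "integrable \<mu> (\<lambda>y. indicat_real ?B y *\<^sub>R \<sigma> y)"
    using int by (intro integrable_mult_indicator) auto
  have ind: "integrable \<mu> (indicat_real (ball x s))" for s
    by (auto simp: integrable_indicator_iff less_top[symmetric])
  \<comment> \<open>With cut-off value \<open>m\<close>, the product of \<open>1 - m\<close> and
    \<open>1 - \<nu> \<bullet> \<sigma> y\<close> is non-negative, so the flux density is at least
    \<open>m\<close> minus the defect \<open>1 - \<nu> \<bullet> \<sigma> y\<close>. On the small
    ball \<open>m\<close> is at least (1 - 1/4)^2 = 9/16.\<close>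
  have "9 / 16 * measure \<mu> (ball x r) - (measure \<mu> ?B - \<nu> \<bullet> (LINT y:?B|\<mu>. \<sigma> y))
     = (LINT y|\<mu>. 9 / 16 * indicator (ball x r) y - (indicator ?B y - \<nu> \<bullet> (indicat_real ?B y *\<^sub>R \<sigma> y)))"
    using ind int_B by (simp add: set_lebesgue_integral_def integrable_inner_right del: inner_scaleR_right)
  also have "\<dots> \<le> (LINT y|\<mu>. \<phi> y \<bullet> \<sigma> y)"
  proof (rule integral_mono_AE)
    show "integrable \<mu> (\<lambda>y. 9 / 16 * indicator (ball x r) y - (indicator ?B y - \<nu> \<bullet> (indicat_real ?B y *\<^sub>R \<sigma> y)))"
      using ind int_B by (intro Bochner_Integration.integrable_diff integrable_mult_right integrable_inner_right) auto
    show "integrable \<mu> (\<lambda>y. \<phi> y \<bullet> \<sigma> y)"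
    proof (rule integrable_const_bound[where B = 1])
      show "AE y in \<mu>. norm (\<phi> y \<bullet> \<sigma> y) \<le> 1"
        using norm1
      proof eventually_elim
        case (elim y)
        have "(paraboloid x (2 * r) y)\<^sup>2 \<le> 1" using paraboloid_nonneg paraboloid_le_1 by (rule power_le_one)
        then have "norm (\<phi> y) \<le> 1" using \<nu> by (simp add: \<phi>_def bump_field_def)
        then show ?case using Cauchy_Schwarz_ineq2[of "\<phi> y" "\<sigma> y"] elim by simp
      qed
    qed simp
    show "AE y in \<mu>. 9 / 16 * indicator (ball x r) y - (indicator ?B y - \<nu> \<bullet> (indicat_real ?B y *\<^sub>R \<sigma> y)) \<le> \<phi> y \<bullet> \<sigma> y"
      using norm1
    proof eventually_elim
      case (elim y)
      define m where "m = (paraboloid x (2 * r) y)\<^sup>2"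
      have "\<nu> \<bullet> \<sigma> y \<le> 1" using Cauchy_Schwarz_ineq2[of \<nu> "\<sigma> y"] elim \<nu> by simp
      moreover have m: "0 \<le> m" "m \<le> 1"
        using power_le_one[OF paraboloid_nonneg paraboloid_le_1] by (auto simp: m_def)
      ultimately have "0 \<le> (1 - m) * (1 - \<nu> \<bullet> \<sigma> y)" by (intro mult_nonneg_nonneg) auto
      then have *: "m - (1 - \<nu> \<bullet> \<sigma> y) \<le> m * (\<nu> \<bullet> \<sigma> y)" by (simp add: algebra_simps)
      have "\<phi> y \<bullet> \<sigma> y = m * (\<nu> \<bullet> \<sigma> y)" by (simp add: \<phi>_def bump_field_def m_def)
      moreover have "9 / 16 \<le> m" if "y \<in> ball x r"
      proof -
        have "3 / 4 \<le> paraboloid x (2 * r) y"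
          using paraboloid_ge[of r y x "2 * r"] that \<open>0 < r\<close> by (simp add: power2_eq_square)
        then have "(3 / 4)\<^sup>2 \<le> m" unfolding m_def by (intro power_mono) auto
        then show ?thesis by (simp add: power2_eq_square)
      qed
      moreover have "m = 0" if "y \<notin> ?B"
        using paraboloid_eq_0[OF _ that] \<open>0 < r\<close> by (simp add: m_def)
      moreover have "ball x r \<subseteq> ?B" using \<open>0 < r\<close> by (intro subset_ball) auto
      ultimately show ?case using * m
        by (cases "y \<in> ball x r"; cases "y \<in> ?B") (auto simp del: mem_ball)
    qed
  qed
  also note upper
  finally have main: "9 / 16 * measure \<mu> (ball x r) \<le> 32 * r + (measure \<mu> ?B - \<nu> \<bullet> (LINT y:?B|\<mu>. \<sigma> y))"
    by linarith
  show ?thesis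
  proof (cases "measure \<mu> ?B = 0")
    case True
    have "measure \<mu> (ball x r) \<le> measure \<mu> ?B"
      using \<open>0 < r\<close> by (intro finite_measure_mono subset_ball) auto
    then show ?thesis using True \<open>0 < r\<close> by simp
  next
    case False
    then have "0 < measure \<mu> ?B" by (simp add: less_le)
    \<comment> \<open>The defect is now at most 9/64 of the mass of the large ball. Dividing by 9/16
      turns it into exactly 1/4, and 32 into 512/9, which is below 57.\<close>
    then have "55 / 64 * measure \<mu> ?B \<le> \<nu> \<bullet> (LINT y:?B|\<mu>. \<sigma> y)"
      using mean by (simp add: field_simps)
    then show ?thesis using main \<open>0 < r\<close> by linarith
  qed
qed

text \<open>The function \<open>2 * C * r + L * r^2\<close> reproduces itself under the recursion:
  the first term is a particular solution, the second solves the homogeneous equation. Being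
  quadratic, the second is eventually below \<open>C * r\<close>, so the initial size of
  \<open>f\<close> disappears from the constant.\<close>

lemma eventually_linear_growth:
  fixes f :: "real \<Rightarrow> real"
  assumes "0 < r0" "0 < C" and mono: "\<And>r s. 0 < r \<Longrightarrow> r \<le> s \<Longrightarrow> f r \<le> f s" and nonneg: "\<And>r. 0 \<le> f r"
    and step: "\<And>r. 0 < r \<Longrightarrow> r < r0 \<Longrightarrow> f r \<le> C * r + f (2 * r) / 4"
  shows "\<forall>\<^sub>F r in at_right 0. f r \<le> 3 * C * r"
proof -
  \<comment> \<open>Makes the quadratic term equal to \<open>f r0\<close> at \<open>r0 / 2\<close>,
    so that the bound holds on the first dyadic interval by monotonicity.\<close>
  define L where "L = 4 * f r0 / r0\<^sup>2"
  have "0 \<le> L" using nonneg by (simp add: L_def)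
  have bound: "f r \<le> 2 * C * r + L * r\<^sup>2" if "0 < r" "r < r0" "r0 / 2 ^ n \<le> r" for n r
    using that
  proof (induction n arbitrary: r)
    case 0
    then show ?case by simp
  next
    case (Suc n)
    show ?case
    proof (cases "r0 / 2 \<le> r")
      case True
      have "f r \<le> f r0" using Suc.prems by (intro mono) auto
      also have "\<dots> = L * (r0 / 2)\<^sup>2" using \<open>0 < r0\<close> by (simp add: L_def power2_eq_square)
      also have "\<dots> \<le> L * r\<^sup>2" using True \<open>0 < r0\<close> \<open>0 \<le> L\<close> by (intro mult_left_mono power_mono) auto
      finally show ?thesis using Suc.prems \<open>0 < C\<close> by (simp add: add_increasing)
    next
      case False
      then have "f (2 * r) \<le> 2 * C * (2 * r) + L * (2 * r)\<^sup>2"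
        using Suc.prems by (intro Suc.IH) (auto simp: field_simps)
      then show ?thesis using step[of r] Suc.prems by (simp add: power2_eq_square)
    qed
  qed
  have "0 < C / (L + 1)" using \<open>0 < C\<close> \<open>0 \<le> L\<close> by simp
  then have "\<forall>\<^sub>F r in at_right 0. r < min r0 (C / (L + 1))"
    using \<open>0 < r0\<close> by (intro eventually_at_rightI[of 0 "min r0 (C / (L + 1))"]) auto
  moreover have "\<forall>\<^sub>F r in at_right 0. (0::real) < r" by (rule eventually_at_right_less)
  ultimately show ?thesis
  proof eventually_elim
    case (elim r)
    obtain n where "(1 / 2) ^ n < r / r0"
      using real_arch_pow_inv[of "r / r0" "1 / 2"] elim \<open>0 < r0\<close> by auto
    then have "r0 / 2 ^ n \<le> r" using \<open>0 < r0\<close> by (simp add: field_simps power_divide)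
    then have "f r \<le> 2 * C * r + L * r\<^sup>2" using elim by (intro bound) auto
    moreover have "L * r \<le> C"
    proof -
      have "(L + 1) * r \<le> C" using elim \<open>0 \<le> L\<close> by (simp add: field_simps)
      then show ?thesis using elim by (simp add: algebra_simps)
    qed
    then have "L * r * r \<le> C * r" using elim by (intro mult_right_mono) auto
    ultimately show ?case by (simp add: power2_eq_square)
  qed
qed

theorem perimeter_linear_growth:
  assumes gg: "gauss_green E (\<mu>, \<sigma>)" and E: "E \<in> sets borel" and \<nu>: "norm \<nu> = 1"
    and lim: "((\<lambda>r. (LINT y:ball x r|\<mu>. \<sigma> y) /\<^sub>R measure \<mu> (ball x r)) \<longlongrightarrow> \<nu>) (at_right 0)"
  shows "\<forall>\<^sub>F r in at_right 0. measure \<mu> (ball x r) \<le> 171 * r"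
proof -
  have sets: "sets \<mu> = sets borel" and fin: "finite_measure \<mu>"
    using gg by (auto simp: gauss_green_def)
  interpret finite_measure \<mu> by fact
  have "((\<lambda>r. \<nu> \<bullet> ((LINT y:ball x r|\<mu>. \<sigma> y) /\<^sub>R measure \<mu> (ball x r))) \<longlongrightarrow> \<nu> \<bullet> \<nu>) (at_right 0)"
    by (intro tendsto_intros lim)
  moreover have "55 / 64 < \<nu> \<bullet> \<nu>" using \<nu> by (simp add: norm_eq_1)
  ultimately have "\<forall>\<^sub>F r in at_right 0. 55 / 64 < \<nu> \<bullet> ((LINT y:ball x r|\<mu>. \<sigma> y) /\<^sub>R measure \<mu> (ball x r))"
    by (rule order_tendstoD)
  then obtain d where d: "0 < d" "\<And>r. 0 < r \<Longrightarrow> r < d \<Longrightarrow>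
      55 / 64 < \<nu> \<bullet> ((LINT y:ball x r|\<mu>. \<sigma> y) /\<^sub>R measure \<mu> (ball x r))"
    unfolding eventually_at_right_field by auto
  have "\<forall>\<^sub>F r in at_right 0. measure \<mu> (ball x r) \<le> 3 * 57 * r"
  proof (rule eventually_linear_growth[of "d / 2"])
    \<comment> \<open>The estimate at \<open>r\<close> uses the average over the ball of radius
      \<open>2 * r\<close>, hence the range up to \<open>d / 2\<close>.\<close>
    show "measure \<mu> (ball x r) \<le> 57 * r + measure \<mu> (ball x (2 * r)) / 4" if "0 < r" "r < d / 2" for r
      using d(2)[of "2 * r"] that by (intro perimeter_doubling_estimate[OF gg E \<nu>]) auto
    show "measure \<mu> (ball x r) \<le> measure \<mu> (ball x s)" if "0 < r" "r \<le> s" for r s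
      using that by (intro finite_measure_mono subset_ball) (auto simp: sets)
  qed (use d in auto)
  then show ?thesis by simp
qed


section \<open>Comparison with the Hausdorff measure on the reduced boundary\<close>

text \<open>The measure of an open ball is lower semicontinuous in its centre: slightly smaller
  concentric balls carry almost all the mass and stay inside the ball after a small shift. This
  supplies the measurability needed to stratify by scale.\<close>

lemma closed_uniform_linear_growth:
  fixes \<mu> :: "(real^2) measure"
  assumes sets: "sets \<mu> = sets borel" and fin: "finite_measure \<mu>" and "0 \<le> C"
  shows "closed {x. \<forall>r. 0 < r \<longrightarrow> r < d \<longrightarrow> measure \<mu> (ball x r) \<le> C * r}"
proof -
  interpret finite_measure \<mu> by fact
  have "closed {x. measure \<mu> (ball x r) \<le> C * r}" if "0 < r" for r
    unfolding closed_def open_contains_ball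
  proof
    fix x assume "x \<in> - {x. measure \<mu> (ball x r) \<le> C * r}"
    then have x: "C * r < measure \<mu> (ball x r)" by simp
    define s where "s n = r - r / real (Suc n)" for n
    have union: "ball x r = (\<Union>n. ball x (s n))"
    proof (intro equalityI subsetI)
      fix y assume "y \<in> ball x r"
      then have "0 < (r - dist x y) / r" using \<open>0 < r\<close> by simp
      then obtain n where "1 / real (Suc n) < (r - dist x y) / r"
        using reals_Archimedean by (auto simp: inverse_eq_divide)
      then have "y \<in> ball x (s n)" using \<open>0 < r\<close> by (simp add: s_def field_simps)
      then show "y \<in> (\<Union>n. ball x (s n))" by blast
    next
      fix y assume "y \<in> (\<Union>n. ball x (s n))"
      then obtain n where "dist x y < s n" by auto
      moreover have "s n \<le> r" using \<open>0 < r\<close> by (simp add: s_def)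
      ultimately show "y \<in> ball x r" by simp
    qed
    have "incseq (\<lambda>n. ball x (s n))"
    proof (rule incseq_SucI, rule subset_ball)
      fix n
      have "r / real (Suc (Suc n)) \<le> r / real (Suc n)" using \<open>0 < r\<close> by (intro divide_left_mono) auto
      then show "s n \<le> s (Suc n)" by (simp add: s_def)
    qed
    then have "(\<lambda>n. measure \<mu> (ball x (s n))) \<longlonglongrightarrow> measure \<mu> (\<Union>n. ball x (s n))"
      by (intro finite_Lim_measure_incseq) (auto simp: sets)
    then have "\<forall>\<^sub>F n in sequentially. C * r < measure \<mu> (ball x (s n))"
      using x by (intro order_tendstoD) (auto simp: union)
    then obtain n where n: "C * r < measure \<mu> (ball x (s n))"
      using eventually_happens trivial_limit_sequentially by blast
    have "ball x (r / real (Suc n)) \<subseteq> - {x. measure \<mu> (ball x r) \<le> C * r}"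
    proof
      fix y assume y: "y \<in> ball x (r / real (Suc n))"
      have "ball x (s n) \<subseteq> ball y r"
      proof
        fix z assume "z \<in> ball x (s n)"
        then show "z \<in> ball y r"
          using y dist_triangle3[of y z x] by (simp add: s_def)
      qed
      then have "measure \<mu> (ball x (s n)) \<le> measure \<mu> (ball y r)"
        by (intro finite_measure_mono) (auto simp: sets)
      then show "y \<in> - {x. measure \<mu> (ball x r) \<le> C * r}" using n by simp
    qed
    then show "\<exists>e>0. ball x e \<subseteq> - {x. measure \<mu> (ball x r) \<le> C * r}"
      using \<open>0 < r\<close> by (intro exI[of _ "r / real (Suc n)"]) simp
  qed
  then have "closed (\<Inter>r\<in>{0<..<d}. {x. measure \<mu> (ball x r) \<le> C * r})"
    by (intro closed_INT) auto
  also have "(\<Inter>r\<in>{0<..<d}. {x. measure \<mu> (ball x r) \<le> C * r}) =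
      {x. \<forall>r. 0 < r \<longrightarrow> r < d \<longrightarrow> measure \<mu> (ball x r) \<le> C * r}"
    by auto
  finally show ?thesis .
qed

text \<open>Each covering set that meets \<open>B\<close> is replaced by the closed ball about one
  of its points in \<open>B\<close> whose radius is the diameter of the set.\<close>

lemma measure_le_hausdorff1_uniform:
  fixes \<mu> :: "(real^2) measure"
  assumes sets [measurable_cong]: "sets \<mu> = sets borel" and fin: "finite_measure \<mu>"
    and "0 < C" and "0 < d"
    and growth: "\<And>x r. x \<in> B \<Longrightarrow> 0 < r \<Longrightarrow> r < d \<Longrightarrow> measure \<mu> (ball x r) \<le> C * r"
  shows "emeasure \<mu> B \<le> ennreal C * hausdorff1_outer B"
proof -
  interpret finite_measure \<mu> by fact
  \<comment> \<open>Closed balls are needed because points may lie exactly at the diameter, and for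
    diameter 0 the open ball would be empty. The bound is the limit of those for slightly larger
    open balls.\<close>
  have cball: "emeasure \<mu> (cball x s) \<le> ennreal C * ennreal s" if "x \<in> B" "0 \<le> s" "s < d" for x s
  proof -
    have "measure \<mu> (cball x s) \<le> C * s + e" if "0 < e" for e
    proof -
      define \<rho> where "\<rho> = min ((s + d) / 2) (s + e / C)"
      have \<rho>: "s < \<rho>" "\<rho> < d" "\<rho> \<le> s + e / C"
        using \<open>s < d\<close> \<open>0 < e\<close> \<open>0 < C\<close> by (auto simp: \<rho>_def min_def field_simps)
      have "measure \<mu> (cball x s) \<le> measure \<mu> (ball x \<rho>)"
        using \<rho> by (intro finite_measure_mono) (auto simp: sets)
      also have "\<dots> \<le> C * \<rho>" using \<rho> \<open>x \<in> B\<close> \<open>0 \<le> s\<close> by (intro growth) auto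
      also have "\<dots> \<le> C * (s + e / C)" using \<rho> \<open>0 < C\<close> by (intro mult_left_mono) auto
      also have "\<dots> = C * s + e" using \<open>0 < C\<close> by (simp add: field_simps)
      finally show ?thesis .
    qed
    then have "measure \<mu> (cball x s) \<le> C * s" by (rule field_le_epsilon)
    then show ?thesis
      using \<open>0 < C\<close> \<open>0 \<le> s\<close> by (simp add: emeasure_eq_measure ennreal_leI ennreal_mult'[symmetric])
  qed
  \<comment> \<open>Diameters up to \<open>d / 2\<close> remain strictly below \<open>d\<close>, as
    the bound on closed balls requires.\<close>
  have "emeasure \<mu> B \<le> ennreal C * (\<Sum>i. ennreal (diameter (D i)))"
    if cover: "B \<subseteq> (\<Union>i. D i)" and D: "\<And>i. bounded (D i)" "\<And>i. diameter (D i) \<le> d / 2"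
    for D :: "nat \<Rightarrow> (real^2) set"
  proof -
    define G where "G i = (if D i \<inter> B = {} then {} else cball (SOME x. x \<in> D i \<inter> B) (diameter (D i)))" for i
    have some: "(SOME x. x \<in> D i \<inter> B) \<in> D i \<inter> B" if "D i \<inter> B \<noteq> {}" for i
      using that some_in_eq by blast
    have [measurable]: "G i \<in> sets \<mu>" for i by (simp add: G_def sets)
    have "B \<subseteq> (\<Union>i. G i)"
    proof
      fix y assume "y \<in> B"
      then obtain i where i: "y \<in> D i" "y \<in> B" using cover by blast
      then have ne: "D i \<inter> B \<noteq> {}" by blast
      have "dist (SOME x. x \<in> D i \<inter> B) y \<le> diameter (D i)"
        using some[OF ne] i D(1)[of i] by (intro diameter_bounded_bound) auto
      then show "y \<in> (\<Union>i. G i)" using ne by (auto simp: G_def)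
    qed
    then have "emeasure \<mu> B \<le> emeasure \<mu> (\<Union>i. G i)" by (intro emeasure_mono) auto
    also have "\<dots> \<le> (\<Sum>i. emeasure \<mu> (G i))" by (rule emeasure_subadditive_countably) auto
    also have "\<dots> \<le> (\<Sum>i. ennreal C * ennreal (diameter (D i)))"
    proof (rule suminf_le)
      show "emeasure \<mu> (G i) \<le> ennreal C * ennreal (diameter (D i))" for i
        using cball[of "SOME x. x \<in> D i \<inter> B" "diameter (D i)"] some[of i] D[of i] \<open>0 < d\<close> diameter_ge_0[of "D i"]
        by (simp add: G_def)
    qed auto
    also have "\<dots> = ennreal C * (\<Sum>i. ennreal (diameter (D i)))" by simp
    finally show ?thesis .
  qed
  then have "emeasure \<mu> B / ennreal C \<le> hausdorff1_pre (d / 2) B"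
    unfolding hausdorff1_pre_def using \<open>0 < C\<close>
    by (intro INF_greatest divide_le_posI_ennreal) auto
  then have "ennreal C * (emeasure \<mu> B / ennreal C) \<le> ennreal C * hausdorff1_pre (d / 2) B"
    by (rule mult_left_mono) simp
  then have "emeasure \<mu> B \<le> ennreal C * hausdorff1_pre (d / 2) B"
    using \<open>0 < C\<close> mult_divide_eq_ennreal[of "ennreal C" "emeasure \<mu> B"]
    by (simp add: ennreal_times_divide mult.commute)
  also have "\<dots> \<le> ennreal C * hausdorff1_outer B"
    using \<open>0 < d\<close> by (intro mult_left_mono hausdorff1_pre_le_outer) auto
  finally show ?thesis .
qed

text \<open>The radius below which growth is linear depends on the point. Stratifying by it gives
  increasing closed sets \<open>A n\<close> on which it is uniform, and continuity from below
  concludes.\<close>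

theorem measure_le_hausdorff1:
  fixes \<mu> :: "(real^2) measure"
  assumes sets [measurable_cong]: "sets \<mu> = sets borel" and fin: "finite_measure \<mu>" and "0 < C"
    and B: "B \<in> sets borel"
    and growth: "\<And>x. x \<in> B \<Longrightarrow> \<forall>\<^sub>F r in at_right 0. measure \<mu> (ball x r) \<le> C * r"
  shows "emeasure \<mu> B \<le> ennreal C * emeasure hausdorff1 B"
proof -
  define A where "A n = {x. \<forall>r. 0 < r \<longrightarrow> r < 1 / real (Suc n) \<longrightarrow> measure \<mu> (ball x r) \<le> C * r}" for n
  have [measurable]: "A n \<in> sets borel" for n
    unfolding A_def using sets fin \<open>0 < C\<close> by (intro borel_closed closed_uniform_linear_growth) auto
  have "incseq (\<lambda>n. B \<inter> A n)"
  proof (intro incseq_SucI Int_mono order_refl)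
    fix n
    have "1 / real (Suc (Suc n)) \<le> 1 / real (Suc n)" by (intro divide_left_mono) auto
    then show "A n \<subseteq> A (Suc n)" unfolding A_def by fastforce
  qed
  moreover have "B = (\<Union>n. B \<inter> A n)"
  proof -
    have "\<exists>n. x \<in> A n" if "x \<in> B" for x
    proof -
      obtain d where d: "0 < d" "\<And>r. 0 < r \<Longrightarrow> r < d \<Longrightarrow> measure \<mu> (ball x r) \<le> C * r"
        using growth[OF \<open>x \<in> B\<close>] unfolding eventually_at_right_field by auto
      obtain n where "1 / real (Suc n) < d"
        using reals_Archimedean[OF d(1)] by (auto simp: inverse_eq_divide)
      then have "x \<in> A n" using d(2) by (auto simp: A_def)
      then show ?thesis ..
    qed
    then show ?thesis by blast
  qed
  ultimately have "emeasure \<mu> B = (SUP n. emeasure \<mu> (B \<inter> A n))"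
    using B by (subst SUP_emeasure_incseq) (auto simp: sets)
  also have "\<dots> \<le> ennreal C * emeasure hausdorff1 B"
  proof (rule SUP_least)
    fix n
    have "emeasure \<mu> (B \<inter> A n) \<le> ennreal C * hausdorff1_outer (B \<inter> A n)"
      by (rule measure_le_hausdorff1_uniform[OF sets fin \<open>0 < C\<close>, of "1 / real (Suc n)"]) (auto simp: A_def)
    also have "\<dots> \<le> ennreal C * hausdorff1_outer B"
      by (intro mult_left_mono hausdorff1_outer_mono) auto
    finally show "emeasure \<mu> (B \<inter> A n) \<le> ennreal C * emeasure hausdorff1 B"
      using B by (simp add: emeasure_hausdorff1)
  qed
  finally show ?thesis .
qed

section \<open>Passage to the reduced boundary and to the anisotropic perimeter\<close>

lemma perimeter_gauss_green:
  assumes "finite_perimeter E"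
  shows "gauss_green E (perimeter_measure E, perimeter_density E)"
  using someI_ex[of "gauss_green E"] assms
  by (auto simp: finite_perimeter_def perimeter_measure_def perimeter_density_def)

text \<open>The exceptional points are enclosed in a measurable null set, and \<open>B\<close> is
  its complement. On it the limit of the mean normals is the density itself, which identifies the
  unit normal and provides the linear growth.\<close>

lemma exists_full_borel_subset_reduced_boundary:
  assumes "finite_perimeter E"
  shows "\<exists>B\<in>sets borel. B \<subseteq> reduced_boundary E \<and> (AE x in perimeter_measure E. x \<in> B) \<and>
    (\<forall>x\<in>B. unit_normal E x = perimeter_density E x) \<and>
    (\<forall>x\<in>B. \<forall>\<^sub>F r in at_right 0. measure (perimeter_measure E) (ball x r) \<le> 171 * r)"
proof -
  let ?\<mu> = "perimeter_measure E" and ?\<sigma> = "perimeter_density E"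
  have gg: "gauss_green E (?\<mu>, ?\<sigma>)" by (rule perimeter_gauss_green[OF assms])
  then have sets: "sets ?\<mu> = sets borel" and fin: "finite_measure ?\<mu>"
    and \<sigma>: "?\<sigma> \<in> borel_measurable borel" and norm1: "AE x in ?\<mu>. norm (?\<sigma> x) = 1"
    by (auto simp: gauss_green_def)
  have "AE x in ?\<mu>. norm (?\<sigma> x) \<le> 1" using norm1 by eventually_elim simp
  from AE_lebesgue_besicovitch[OF sets fin \<sigma> this] norm1
  have "AE x in ?\<mu>. norm (?\<sigma> x) = 1 \<and> (\<forall>r>0. 0 < measure ?\<mu> (ball x r)) \<and> (mean_normal E x \<longlongrightarrow> ?\<sigma> x) (at_right 0)"
    by eventually_elim (simp add: mean_normal_def[abs_def])
  then obtain N where N: "N \<in> sets ?\<mu>" "emeasure ?\<mu> N = 0"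
    "{x \<in> space ?\<mu>. \<not> (norm (?\<sigma> x) = 1 \<and> (\<forall>r>0. 0 < measure ?\<mu> (ball x r)) \<and> (mean_normal E x \<longlongrightarrow> ?\<sigma> x) (at_right 0))} \<subseteq> N"
    by (rule AE_E) blast
  have space: "space ?\<mu> = UNIV" using sets_eq_imp_space_eq[OF sets] by simp
  have good: "norm (?\<sigma> x) = 1" "\<forall>r>0. 0 < measure ?\<mu> (ball x r)" "(mean_normal E x \<longlongrightarrow> ?\<sigma> x) (at_right 0)"
    if "x \<in> - N" for x
    using N(3) that by (auto simp: space)
  show ?thesis
  proof (intro bexI[of _ "- N"] conjI ballI)
    show "- N \<in> sets borel" using N(1) by (simp add: sets)
    show "- N \<subseteq> reduced_boundary E"
    proof
      fix x assume "x \<in> - N"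
      then show "x \<in> reduced_boundary E"
        using good[of x] by (auto simp: reduced_boundary_def intro!: exI[of _ "?\<sigma> x"])
    qed
    show "AE x in ?\<mu>. x \<in> - N"
      using N(1,2) by (intro AE_I[of _ _ N]) auto
    fix x assume x: "x \<in> - N"
    show "unit_normal E x = ?\<sigma> x"
      unfolding unit_normal_def using good(3)[OF x] by (intro tendsto_Lim) auto
    show "\<forall>\<^sub>F r in at_right 0. measure ?\<mu> (ball x r) \<le> 171 * r"
      using assms good[OF x]
      by (intro perimeter_linear_growth[OF gg]) (auto simp: finite_perimeter_def mean_normal_def[abs_def])
  qed
qed

theorem area_le_aniso_perimeter:
  assumes "finite_perimeter E" "E \<subseteq> ball 0 R" "0 < R" and K: "\<And>v. \<bar>v $ 1\<bar> \<le> polar_norm K v"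
  shows "emeasure lborel E \<le> ennreal (1368 * R) * aniso_perimeter K E"
proof -
  let ?\<mu> = "perimeter_measure E" and ?\<sigma> = "perimeter_density E"
  have gg: "gauss_green E (?\<mu>, ?\<sigma>)" by (rule perimeter_gauss_green[OF assms(1)])
  then have sets [measurable_cong]: "sets ?\<mu> = sets borel" and fin: "finite_measure ?\<mu>"
    and \<sigma> [measurable]: "?\<sigma> \<in> borel_measurable borel"
    by (auto simp: gauss_green_def)
  obtain B where B [measurable]: "B \<in> sets borel" and Bsub: "B \<subseteq> reduced_boundary E"
    and AE_B: "AE x in ?\<mu>. x \<in> B"
    and normal: "\<And>x. x \<in> B \<Longrightarrow> unit_normal E x = ?\<sigma> x"
    and growth: "\<And>x. x \<in> B \<Longrightarrow> \<forall>\<^sub>F r in at_right 0. measure ?\<mu> (ball x r) \<le> 171 * r"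
    using exists_full_borel_subset_reduced_boundary[OF assms(1)] by auto
  define f where "f x = ennreal \<bar>?\<sigma> x $ 1\<bar>" for x
  have [measurable]: "f \<in> borel_measurable borel" unfolding f_def by measurable
  \<comment> \<open>The inequality on Borel subsets of \<open>B\<close> is phrased as an order
    between measures, so that it passes to integrals of \<open>f\<close> at once.\<close>
  have le: "density ?\<mu> (indicator B) \<le> density hausdorff1 (\<lambda>x. ennreal 171 * indicator B x)"
    unfolding le_measure[OF trans[OF sets_density trans[OF sets trans[OF sets_hausdorff1[symmetric] sets_density[symmetric]]]]]
  proof (intro ballI)
    fix A assume "A \<in> sets (density ?\<mu> (indicator B))"
    then have [measurable]: "A \<in> sets borel" by (simp add: sets)
    have "emeasure (density ?\<mu> (indicator B)) A = emeasure ?\<mu> (A \<inter> B)"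
      by (subst emeasure_density) (auto simp: sets nn_integral_indicator indicator_inter_arith[symmetric] Int_commute)
    also have "\<dots> \<le> ennreal 171 * emeasure hausdorff1 (A \<inter> B)"
      using growth by (intro measure_le_hausdorff1 sets fin) auto
    also have "\<dots> = (\<integral>\<^sup>+x. ennreal 171 * indicator (A \<inter> B) x \<partial>hausdorff1)"
      by (subst nn_integral_cmult_indicator) auto
    also have "\<dots> = emeasure (density hausdorff1 (\<lambda>x. ennreal 171 * indicator B x)) A"
      by (subst emeasure_density) (auto intro!: nn_integral_cong split: split_indicator)
    finally show "emeasure (density ?\<mu> (indicator B)) A \<le> emeasure (density hausdorff1 (\<lambda>x. ennreal 171 * indicator B x)) A" .
  qed
  have "(\<integral>\<^sup>+x. f x \<partial>?\<mu>) = (\<integral>\<^sup>+x. indicator B x * f x \<partial>?\<mu>)"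
    using AE_B by (intro nn_integral_cong_AE) (auto elim!: eventually_mono)
  also have "\<dots> = (\<integral>\<^sup>+x. f x \<partial>density ?\<mu> (indicator B))"
    by (subst nn_integral_density) auto
  also have "\<dots> \<le> (\<integral>\<^sup>+x. f x \<partial>density hausdorff1 (\<lambda>x. ennreal 171 * indicator B x))"
    by (rule nn_integral_mono_measure[OF _ le]) (simp add: sets)
  also have "\<dots> = (\<integral>\<^sup>+x. ennreal 171 * indicator B x * f x \<partial>hausdorff1)"
    by (subst nn_integral_density) auto
  also have "\<dots> = ennreal 171 * (\<integral>\<^sup>+x. indicator B x * f x \<partial>hausdorff1)"
    by (subst nn_integral_cmult[symmetric]) (auto simp: mult.assoc)
  \<comment> \<open>Monotonicity of \<open>nn_integral\<close> is pointwise and covers arbitrary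
    integrands, so it applies to the reduced boundary although its measurability is not
    established.\<close>
  also have "(\<integral>\<^sup>+x. indicator B x * f x \<partial>hausdorff1) \<le>
      (\<integral>\<^sup>+x\<in>reduced_boundary E. ennreal (polar_norm K (unit_normal E x)) \<partial>hausdorff1)"
    using Bsub normal K by (intro nn_integral_mono) (auto simp: f_def ennreal_leI split: split_indicator)
  also have "\<dots> = aniso_perimeter K E" using assms(1) by (simp add: aniso_perimeter_def)
  finally have *: "(\<integral>\<^sup>+x. f x \<partial>?\<mu>) \<le> ennreal 171 * aniso_perimeter K E" by (simp add: mult_left_mono)
  have "emeasure lborel E \<le> ennreal (8 * R) * (\<integral>\<^sup>+x. f x \<partial>?\<mu>)"
    unfolding f_def using assms by (intro area_le_directional_perimeter[OF gg]) (auto simp: finite_perimeter_def)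
  also have "\<dots> \<le> ennreal (8 * R) * (ennreal 171 * aniso_perimeter K E)"
    using * by (rule mult_left_mono) simp
  also have "\<dots> = ennreal (1368 * R) * aniso_perimeter K E"
    using \<open>0 < R\<close> by (subst mult.assoc[symmetric], subst ennreal_mult[symmetric]) auto
  finally show ?thesis .
qed


section \<open>Thin rectangles\<close>

text \<open>Openness of \<open>K\<close> lets every point be pushed outward, which makes the strict
  inequality in \<open>polar\<close> equivalent to a weak one. A ball about 0 inside
  \<open>K\<close> gives boundedness. Compactness ensures finite area; \<open>measure\<close> would
  return 0 on a set of infinite measure.\<close>

lemma compact_polar:
  assumes "open K" "0 \<in> K"
  shows "compact (polar K)"
proof -
  have "x \<bullet> y < 1" if x: "\<And>y. y \<in> K \<Longrightarrow> x \<bullet> y \<le> 1" and "y \<in> K" for x y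
  proof -
    obtain e where e: "0 < e" "ball y e \<subseteq> K" using \<open>open K\<close> \<open>y \<in> K\<close> open_contains_ball by blast
    define s where "s = (e / 2) / (norm y + 1)"
    have n: "0 < norm y + 1" by (simp add: add_nonneg_pos)
    then have "s * (norm y + 1) = e / 2" unfolding s_def by (intro nonzero_eq_divide_eq[THEN iffD1]) auto
    moreover have "0 < s" using e(1) n by (simp add: s_def)
    ultimately have s: "0 < s" "s * norm y < e" using e(1) by (auto simp: algebra_simps)
    then have "y + s *\<^sub>R y \<in> K" using e(2) by (intro subsetD[OF e(2)]) (simp add: dist_norm)
    then have "(1 + s) * (x \<bullet> y) \<le> 1" using x by (fastforce simp: inner_add_right algebra_simps)
    moreover have "1 + s \<le> (1 + s) * (x \<bullet> y)" if "1 \<le> x \<bullet> y"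
      using s(1) that mult_left_mono[of 1 "x \<bullet> y" "1 + s"] by simp
    ultimately show ?thesis using s(1) by fastforce
  qed
  then have eq: "polar K = (\<Inter>y\<in>K. {x. x \<bullet> y \<le> 1})"
    unfolding polar_def by (auto intro: less_imp_le)
  have "closed (polar K)"
    unfolding eq by (intro closed_INT ballI closed_Collect_le continuous_intros)
  moreover have "bounded (polar K)"
  proof -
    obtain e where e: "0 < e" "ball 0 e \<subseteq> K" using assms open_contains_ball by blast
    have "norm x \<le> 2 / e" if x: "x \<in> polar K" for x
    proof (cases "x = 0")
      case False
      have "(e / 2 / norm x) *\<^sub>R x \<in> K" using e False by (intro subsetD[OF e(2)]) auto
      then have "x \<bullet> ((e / 2 / norm x) *\<^sub>R x) < 1" using x by (auto simp: polar_def)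
      then show ?thesis
        using False e(1) by (simp add: field_simps power2_norm_eq_inner[symmetric] power2_eq_square)
    qed (use e in auto)
    then show ?thesis by (auto simp: bounded_iff)
  qed
  ultimately show ?thesis by (simp add: compact_eq_bounded_closed)
qed

definition rectangle :: "real \<Rightarrow> (real^2) set" where
  "rectangle \<epsilon> = {x. \<bar>x $ 1\<bar> < 1 \<and> \<bar>x $ 2\<bar> < \<epsilon>}"

lemma rectangle_eq_box: "rectangle \<epsilon> = box (vector [-1, -\<epsilon>]) (vector [1, \<epsilon>])"
  by (auto simp: rectangle_def mem_box_cart forall_2 abs_less_iff)

lemma rectangle_sym_convex: "0 < \<epsilon> \<Longrightarrow> rectangle \<epsilon> \<in> sym_convex_sets"
proof -
  assume "0 < \<epsilon>"
  then have "0 \<in> rectangle \<epsilon>" by (simp add: rectangle_def)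
  moreover have "open (rectangle \<epsilon>)" "bounded (rectangle \<epsilon>)" "convex (rectangle \<epsilon>)"
    unfolding rectangle_eq_box by (rule open_box bounded_box convex_box)+
  moreover have "\<forall>x\<in>rectangle \<epsilon>. - x \<in> rectangle \<epsilon>" by (simp add: rectangle_def)
  ultimately show ?thesis unfolding sym_convex_sets_def by blast
qed

text \<open>The points \<open>(t * sgn (v $ 1), 0)\<close> with \<open>t < 1\<close> lie in every
  rectangle, however thin, so the bound does not depend on \<open>\<epsilon>\<close>.\<close>

lemma polar_norm_rectangle_ge:
  assumes "0 < \<epsilon>"
  shows "\<bar>v $ 1\<bar> \<le> polar_norm (rectangle \<epsilon>) v"
proof (rule field_le_mult_one_interval)
  fix t :: real assume t: "0 < t" "t < 1"
  define y :: "real^2" where "y = (t * sgn (v $ 1)) *\<^sub>R axis 1 1"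
  have "\<bar>t * sgn (v $ 1)\<bar> < 1" using t by (simp add: abs_mult abs_sgn_eq)
  then have "y \<in> rectangle \<epsilon>" using \<open>0 < \<epsilon>\<close> by (simp add: rectangle_def y_def axis_def)
  moreover have "bdd_above ((\<lambda>y. v \<bullet> y) ` rectangle \<epsilon>)"
  proof (rule bounded_imp_bdd_above, rule bounded_linear_image)
    show "bounded (rectangle \<epsilon>)" unfolding rectangle_eq_box by (rule bounded_box)
  qed (rule bounded_linear_inner_right)
  ultimately have "v \<bullet> y \<le> polar_norm (rectangle \<epsilon>) v"
    unfolding polar_norm_def by (intro cSUP_upper)
  moreover have "v \<bullet> y = t * \<bar>v $ 1\<bar>"
    by (simp add: y_def inner_axis abs_sgn)
  ultimately show "t * \<bar>v $ 1\<bar> \<le> polar_norm (rectangle \<epsilon>) v" by simp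
qed

text \<open>The polar set is the rhombus
  \<open>\<bar>x $ 1\<bar> + \<epsilon> * \<bar>x $ 2\<bar> \<le> 1\<close>, and the inscribed box
  \<open>Q\<close>, with half its semi-axes, already has area \<open>1 / \<epsilon>\<close>.\<close>

lemma measure_polar_rectangle_ge:
  assumes "0 < \<epsilon>"
  shows "1 / \<epsilon> \<le> measure lborel (polar (rectangle \<epsilon>))"
proof -
  define Q :: "(real^2) set" where "Q = cbox (vector [-1/2, -1/(2*\<epsilon>)]) (vector [1/2, 1/(2*\<epsilon>)])"
  have "Q \<noteq> {}" using \<open>0 < \<epsilon>\<close> by (simp add: Q_def interval_ne_empty_cart forall_2)
  then have "measure lborel Q = 1 / \<epsilon>"
    using \<open>0 < \<epsilon>\<close> unfolding Q_def by (subst content_cbox_cart) (auto simp: UNIV_2)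
  moreover have "measure lborel Q \<le> measure lborel (polar (rectangle \<epsilon>))"
  proof (rule measure_mono_fmeasurable)
    show "Q \<subseteq> polar (rectangle \<epsilon>)"
    proof
      fix x assume x: "x \<in> Q"
      have "x \<bullet> y < 1" if "y \<in> rectangle \<epsilon>" for y
      proof -
        have "x \<bullet> y = x $ 1 * y $ 1 + x $ 2 * y $ 2" by (simp add: inner_vec_def sum_2)
        also have "\<dots> \<le> \<bar>x $ 1\<bar> * \<bar>y $ 1\<bar> + \<bar>x $ 2\<bar> * \<bar>y $ 2\<bar>"
          by (intro add_mono) (metis abs_ge_self abs_mult)+
        also have "\<dots> \<le> 1/2 * \<bar>y $ 1\<bar> + 1/(2*\<epsilon>) * \<bar>y $ 2\<bar>"
          using x by (intro add_mono mult_right_mono) (auto simp: Q_def mem_box_cart forall_2 abs_le_iff)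
        also have "\<dots> < 1/2 * 1 + 1/(2*\<epsilon>) * \<epsilon>"
          using that \<open>0 < \<epsilon>\<close> by (intro add_strict_mono mult_strict_left_mono) (auto simp: rectangle_def)
        finally show ?thesis using \<open>0 < \<epsilon>\<close> by simp
      qed
      then show "x \<in> polar (rectangle \<epsilon>)" by (simp add: polar_def)
    qed
    have "compact (polar (rectangle \<epsilon>))"
    proof (rule compact_polar)
      show "open (rectangle \<epsilon>)" unfolding rectangle_eq_box by (rule open_box)
      show "0 \<in> rectangle \<epsilon>" using \<open>0 < \<epsilon>\<close> by (simp add: rectangle_def)
    qed
    then show "polar (rectangle \<epsilon>) \<in> fmeasurable lborel" by (rule fmeasurable_compact)
  qed (simp add: Q_def)
  ultimately show ?thesis by simp
qed

section \<open>Uniform lower bound for the Cheeger constants and the conclusion\<close>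

lemma cheeger_const_ge:
  assumes "\<Omega> \<subseteq> ball 0 R" "0 < R" and K: "\<And>v. \<bar>v $ 1\<bar> \<le> polar_norm K v"
  shows "ennreal (1 / (1368 * R)) \<le> cheeger_const K \<Omega>"
  unfolding cheeger_const_def
proof (rule INF_greatest)
  fix E assume "E \<in> {E \<in> sets borel. E \<subseteq> \<Omega> \<and> emeasure lborel E > 0}"
  then have E: "E \<in> sets borel" "E \<subseteq> ball 0 R" "0 < emeasure lborel E" using assms by auto
  have "emeasure lborel E \<le> emeasure lborel (ball (0::real^2) R)"
    using E by (intro emeasure_mono) auto
  also have "\<dots> < \<infinity>" by (rule emeasure_bounded_finite) simp
  finally have fin: "emeasure lborel E < \<infinity>" .
  show "ennreal (1 / (1368 * R)) \<le> aniso_perimeter K E / emeasure lborel E"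
  proof (cases "finite_perimeter E")
    case True
    have inv: "ennreal (1 / (1368 * R)) * ennreal (1368 * R) = 1"
      using \<open>0 < R\<close> by (simp add: ennreal_mult'[symmetric])
    have "ennreal (1 / (1368 * R)) * emeasure lborel E \<le>
        ennreal (1 / (1368 * R)) * (ennreal (1368 * R) * aniso_perimeter K E)"
      by (intro mult_left_mono area_le_aniso_perimeter[OF True E(2) \<open>0 < R\<close> K]) auto
    also have "\<dots> = aniso_perimeter K E" by (simp only: mult.assoc[symmetric] inv mult_1_left)
    finally have "ennreal (1 / (1368 * R)) * emeasure lborel E / emeasure lborel E \<le> aniso_perimeter K E / emeasure lborel E"
      by (rule divide_right_mono_ennreal)
    then show ?thesis using E(3) fin by (subst (asm) mult_divide_eq_ennreal) auto
  next
    \<comment> \<open>Finiteness of the area matters: in \<open>ennreal\<close> the quotient of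
      infinity by a finite number is infinity, but infinity by infinity is 0.\<close>
    case False
    then show ?thesis using fin by (simp add: aniso_perimeter_def ennreal_top_divide)
  qed
qed

theorem corollary3p2:
  fixes \<Omega> :: "(real^2) set"
  assumes "\<Omega> \<noteq> {}" and "open \<Omega>" and "bounded \<Omega>" and "convex \<Omega>"
  shows "(SUP K\<in>sym_convex_sets. cheeger_functional \<Omega> K) = \<infinity>"
proof -
  obtain R where R: "0 < R" "\<Omega> \<subseteq> ball 0 R"
    using bounded_subset_ballD[OF \<open>bounded \<Omega>\<close>] by blast
  have "of_nat n \<le> (SUP K\<in>sym_convex_sets. cheeger_functional \<Omega> K)" for n
  proof -
    \<comment> \<open>With \<open>\<epsilon> = 1 / t^2\<close> the square root of the polar area is
      at least \<open>t\<close>, and \<open>t\<close> is scaled to cancel the Cheeger bound, leaving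
      \<open>n + 1\<close>.\<close>
    define t where "t = 1368 * R * real (Suc n)"
    have "0 < t" using R by (simp add: t_def)
    define K where "K = rectangle (1 / t\<^sup>2)"
    have "0 < 1 / t\<^sup>2" using \<open>0 < t\<close> by simp
    have "t = sqrt (1 / (1 / t\<^sup>2))" using \<open>0 < t\<close> by simp
    also have "\<dots> \<le> sqrt (measure lborel (polar K))"
      unfolding K_def using \<open>0 < 1 / t\<^sup>2\<close> by (intro real_sqrt_le_mono measure_polar_rectangle_ge)
    finally have "ennreal (1 / (1368 * R)) * ennreal t \<le> cheeger_functional \<Omega> K"
      unfolding cheeger_functional_def K_def
      using R \<open>0 < 1 / t\<^sup>2\<close>
      by (intro mult_mono cheeger_const_ge ennreal_leI polar_norm_rectangle_ge) auto
    moreover have "1 / (1368 * R) * t = real (Suc n)" using R by (simp add: t_def)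
    then have "ennreal (1 / (1368 * R)) * ennreal t = ennreal (real (Suc n))"
      using R by (simp add: ennreal_mult'[symmetric])
    moreover have "of_nat n \<le> ennreal (real (Suc n))"
      by (simp add: ennreal_of_nat_eq_real_of_nat ennreal_leI)
    moreover have "cheeger_functional \<Omega> K \<le> (SUP K\<in>sym_convex_sets. cheeger_functional \<Omega> K)"
      unfolding K_def using \<open>0 < 1 / t\<^sup>2\<close> by (intro SUP_upper rectangle_sym_convex)
    ultimately show ?thesis by (metis order_trans)
  qed
  then have "(SUP n. of_nat n) \<le> (SUP K\<in>sym_convex_sets. cheeger_functional \<Omega> K)"
    by (intro SUP_least)
  then show ?thesis
    by (simp add: ennreal_SUP_of_nat_eq_top top_unique)
qed

end
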